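(* Let $S$ be a string of length $n$ over an alphabet $\Sigma$ in which each letter appears at most 3 times. Whether $S$ has a letter-duplicated subsequence in which every letter of $\Sigma$ appears (i.e., whether FT$(3)$ has a solution) can be decided in $O(n^2)$ time.
   Context: A subsequence of $S$ is a letter-duplicated subsequence (LDS) if it has the form $x_1^{d_1}x_2^{d_2}\cdots x_k^{d_k}$ with $x_i\in\Sigma$, $x_j\neq x_{j+1}$ and $d_i\geq 2$ for all $i\in[k]$, $j\in[k-1]$. *)

theory Defs
  imports Complex_Main "HOL-Library.Sublist" "HOL-Library.Landau_Symbols"
begin

section \<open>Letter-duplicated subsequences\<close>

text \<open>The word \<open>x\<^sub>1^d\<^sub>1 \<dots> x\<^sub>k^d\<^sub>k\<close> is given by the list of its blocks
  \<open>(x\<^sub>i, d\<^sub>i)\<close>; the empty word (\<open>k = 0\<close>) is admitted.\<close>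

definition letter_duplicated :: "'a set \<Rightarrow> 'a list \<Rightarrow> bool" where
  "letter_duplicated \<Sigma> w \<longleftrightarrow>
     (\<exists>bs :: ('a \<times> nat) list.
        w = concat (map (\<lambda>(x, d). replicate d x) bs) \<and>
        (\<forall>i < length bs. fst (bs ! i) \<in> \<Sigma> \<and> snd (bs ! i) \<ge> 2) \<and>
        (\<forall>j. Suc j < length bs \<longrightarrow> fst (bs ! j) \<noteq> fst (bs ! Suc j)))"

definition is_LDS :: "'a set \<Rightarrow> 'a list \<Rightarrow> 'a list \<Rightarrow> bool" where
  "is_LDS \<Sigma> S w \<longleftrightarrow> subseq w S \<and> letter_duplicated \<Sigma> w"

text \<open>An instance of \<open>FT(d)\<close> is a pair \<open>(\<sigma>, S)\<close>: the alphabet is \<open>{0, \<dots>, \<sigma> - 1}\<close>,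
  and \<open>S\<close> is a string over it. Letters of the alphabet may be absent from \<open>S\<close>.\<close>

definition FT_instances :: "nat \<Rightarrow> (nat \<times> nat list) set" where
  "FT_instances d = {(\<sigma>, S). set S \<subseteq> {..<\<sigma>} \<and> (\<forall>a < \<sigma>. count_list S a \<le> d)}"

definition FT_solvable :: "nat \<times> nat list \<Rightarrow> bool" where
  "FT_solvable = (\<lambda>(\<sigma>, S). \<exists>w. is_LDS {..<\<sigma>} S w \<and> {..<\<sigma>} \<subseteq> set w)"

definition FT_size :: "nat \<times> nat list \<Rightarrow> nat" where
  "FT_size = (\<lambda>(\<sigma>, S). length S)"

definition FT_encoding :: "nat \<times> nat list \<Rightarrow> nat list" where
  "FT_encoding = (\<lambda>(\<sigma>, S). \<sigma> # length S # S)"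

section \<open>Random access machines\<close>

text \<open>A random access machine in the style of Cook and Reckhow, with registers
  \<open>X\<^sub>0, X\<^sub>1, \<dots>\<close> over the natural numbers and a read-once input tape; every instruction
  takes one time step. Subtraction is truncated at zero, and reading past the end of the
  input yields zero.\<close>

datatype instr =
    Const nat nat      \<comment> \<open>\<open>X\<^sub>i := c\<close>\<close>
  | Add nat nat nat    \<comment> \<open>\<open>X\<^sub>i := X\<^sub>j + X\<^sub>k\<close>\<close>
  | Sub nat nat nat    \<comment> \<open>\<open>X\<^sub>i := X\<^sub>j - X\<^sub>k\<close>\<close>
  | Load nat nat       \<comment> \<open>\<open>X\<^sub>i := X[X\<^sub>j]\<close>\<close>
  | Store nat nat      \<comment> \<open>\<open>X[X\<^sub>i] := X\<^sub>j\<close>\<close>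
  | JumpPos nat nat    \<comment> \<open>if \<open>X\<^sub>i > 0\<close> go to instruction \<open>l\<close>\<close>
  | Read nat           \<comment> \<open>\<open>X\<^sub>i := \<close> next input value\<close>

text \<open>A configuration consists of the program counter, the registers and the unread input.\<close>

type_synonym config = "nat \<times> (nat \<Rightarrow> nat) \<times> nat list"

fun exec :: "instr \<Rightarrow> config \<Rightarrow> config" where
  "exec (Const i c) (pc, X, xs) = (pc + 1, X(i := c), xs)"
| "exec (Add i j k) (pc, X, xs) = (pc + 1, X(i := X j + X k), xs)"
| "exec (Sub i j k) (pc, X, xs) = (pc + 1, X(i := X j - X k), xs)"
| "exec (Load i j) (pc, X, xs) = (pc + 1, X(i := X (X j)), xs)"
| "exec (Store i j) (pc, X, xs) = (pc + 1, X(X i := X j), xs)"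
| "exec (JumpPos i l) (pc, X, xs) = (if X i > 0 then l else pc + 1, X, xs)"
| "exec (Read i) (pc, X, xs) =
     (pc + 1, X(i := (case xs of [] \<Rightarrow> 0 | x # _ \<Rightarrow> x)), tl xs)"

definition halted :: "instr list \<Rightarrow> config \<Rightarrow> bool" where
  "halted p c \<longleftrightarrow> fst c \<ge> length p"

definition step :: "instr list \<Rightarrow> config \<Rightarrow> config" where
  "step p c = (if halted p c then c else exec (p ! fst c) c)"

definition run :: "instr list \<Rightarrow> nat list \<Rightarrow> nat \<Rightarrow> config" where
  "run p xs t = (step p ^^ t) (0, (\<lambda>_. 0), xs)"

definition reg :: "config \<Rightarrow> nat \<Rightarrow> nat" where
  "reg c = fst (snd c)"

text \<open>The answer is read off register \<open>X\<^sub>0\<close> on halting. In order that unit cost per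
  instruction be justified, the registers may only ever hold values polynomial in the length
  and the largest entry of the input, i.e. words of logarithmically many bits.\<close>

definition word_bounded :: "instr list \<Rightarrow> nat \<Rightarrow> nat list \<Rightarrow> bool" where
  "word_bounded p k xs \<longleftrightarrow>
     (\<forall>t i. reg (run p xs t) i \<le> (length xs + Max (insert 0 (set xs)) + 2) ^ k)"

definition decides_within :: "instr list \<Rightarrow> nat list \<Rightarrow> bool \<Rightarrow> nat \<Rightarrow> bool" where
  "decides_within p xs b t \<longleftrightarrow>
     halted p (run p xs t) \<and> reg (run p xs t) 0 = (if b then 1 else 0)"

text \<open>The decision problem \<open>Q\<close> on the set \<open>I\<close> of instances, with input encoding \<open>enc\<close>, can be
  decided in time \<open>O(f(n))\<close>, where \<open>n\<close> is the size of the instance. Nothing is required of the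
  program on inputs that do not encode an element of \<open>I\<close>.\<close>

definition decidable_in_time_O ::
  "'i set \<Rightarrow> ('i \<Rightarrow> nat list) \<Rightarrow> ('i \<Rightarrow> nat) \<Rightarrow> ('i \<Rightarrow> bool) \<Rightarrow> (nat \<Rightarrow> real) \<Rightarrow> bool" where
  "decidable_in_time_O I enc sz Q f \<longleftrightarrow>
     (\<exists>p k (T :: nat \<Rightarrow> nat).
        (\<lambda>n. real (T n)) \<in> O(f) \<and>
        (\<forall>x \<in> I. word_bounded p k (enc x) \<and>
                 decides_within p (enc x) (Q x) (T (sz x))))"

end

theory Submission
  imports Defs
begin

text \<open>
  A letter occurring at most three times can form at most one block, and this block may be assumed to
  use two consecutive occurrences of the letter. So every letter chooses one of at most two intervals
  of positions (identified below with their right ends), and a solution is a choice of pairwise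
  disjoint intervals. This is a 2-SAT instance with up to quadratically many clauses.

  A pairwise disjoint choice \<open>C\<close> is maintained while the letters are inserted one by one. In order
  to insert a letter with interval \<open>e0\<close>, the positions of \<open>e0\<close> are claimed one after the other;
  whenever a position belongs to an interval of \<open>C\<close>, the letter of that interval is forced to flip
  to its other interval, which is queued in order to be claimed as well. If there is no other
  interval, or if a position is claimed twice, then \<open>e0\<close> belongs to no solution; otherwise the
  flipped choice is again pairwise disjoint. No position is claimed twice before an attempt ends,
  so an attempt takes linear time, and each letter needs at most two attempts.

  The algorithm is written in a small imperative language, which is compiled to the machine. As the
  programs of this language increase values only by one at a time, word-boundedness follows from the
  time bound.\<close>

section \<open>Solutions as choices of disjoint intervals\<close>

text \<open>The delicate point is that decisions for earlier letters never have to be searched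
  through again. A flip made while claiming \<open>e0\<close> follows from \<open>e0\<close> alone:
  the displaced letter must occur in every solution, and its present interval meets one that every
  solution through \<open>e0\<close> contains. So failure excludes \<open>e0\<close> from all
  solutions over the full alphabet, not merely from those close to \<open>C\<close>, and a letter
  all of whose intervals fail makes the instance unsolvable.

  The quadratically many conflicts are never listed. A table from positions to the interval of
  \<open>C\<close> covering them finds the displaced letter in constant time, and the cost is
  charged to the positions claimed. As a search may fail, claims and flips live in scratch arrays
  and reach the table only on success.

  The size of an instance is \<open>length S\<close> alone, while the alphabet may be larger; an
  alphabet with more letters than positions is therefore rejected before the loop over its
  letters.\<close>

text \<open>Positions are counted from 1, and 0 stands for a missing occurrence.\<close>

primrec last_occ :: "'a list \<Rightarrow> 'a \<Rightarrow> nat \<Rightarrow> nat" where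
  "last_occ S a 0 = 0"
| "last_occ S a (Suc i) = (if S ! i = a then Suc i else last_occ S a i)"

definition letter :: "'a list \<Rightarrow> nat \<Rightarrow> 'a" where
  "letter S k = S ! (k - 1)"

definition prv :: "'a list \<Rightarrow> nat \<Rightarrow> nat" where
  "prv S k = last_occ S (letter S k) (k - 1)"

definition right_ends :: "'a list \<Rightarrow> nat set" where
  "right_ends S = {e. e \<le> length S \<and> prv S e > 0}"

definition ival :: "'a list \<Rightarrow> nat \<Rightarrow> nat set" where
  "ival S e = {prv S e..e}"

text \<open>The letter set \<open>B\<close> is a parameter because the program maintains a choice
  for an initial segment of the alphabet.\<close>

definition valid :: "'a list \<Rightarrow> nat set \<Rightarrow> 'a set \<Rightarrow> bool" where
  "valid S C B \<longleftrightarrow> C \<subseteq> right_ends S \<and> inj_on (letter S) C \<and> letter S ` C = B \<and>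
     (\<forall>d\<in>C. \<forall>e\<in>C. d \<noteq> e \<longrightarrow> ival S d \<inter> ival S e = {})"

lemma last_occ_le: "last_occ S a i \<le> i"
  by (induction i) auto

lemma last_occ_letter: "last_occ S a i > 0 \<Longrightarrow> letter S (last_occ S a i) = a"
  by (induction i) (auto simp: letter_def split: if_splits)

lemma last_occ_greatest: "0 < j \<Longrightarrow> j \<le> i \<Longrightarrow> letter S j = a \<Longrightarrow> j \<le> last_occ S a i"
proof (induction i)
  case (Suc i)
  then show ?case by (cases "j = Suc i") (auto simp: letter_def)
qed simp

lemma prv_0 [simp]: "prv S 0 = 0"
  by (simp add: prv_def)

lemma prv_less: "0 < prv S k \<Longrightarrow> prv S k < k"
  using last_occ_le[of S "letter S k" "k - 1"] by (cases k) (auto simp: prv_def)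

lemma prv_letter: "0 < prv S k \<Longrightarrow> letter S (prv S k) = letter S k"
  by (simp add: prv_def last_occ_letter)

lemma prv_greatest: "0 < j \<Longrightarrow> j < k \<Longrightarrow> letter S j = letter S k \<Longrightarrow> j \<le> prv S k"
  by (simp add: prv_def last_occ_greatest)

lemma right_endsD:
  assumes "e \<in> right_ends S"
  shows "0 < prv S e" "prv S e < e" "0 < e" "e \<le> length S"
  using assms prv_less[of S e] by (auto simp: right_ends_def)

lemma ival_subset: "e \<in> right_ends S \<Longrightarrow> ival S e \<subseteq> {1..length S}"
  using right_endsD[of e S] by (auto simp: ival_def)

lemma right_end_in_ival: "e \<in> right_ends S \<Longrightarrow> e \<in> ival S e"
  using right_endsD[of e S] by (auto simp: ival_def)

section \<open>Duplicated subsequences versus disjoint intervals\<close>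

lemma subseq_pair_iff:
  "subseq [x, y] T \<longleftrightarrow> (\<exists>i j. i < j \<and> j < length T \<and> T ! i = x \<and> T ! j = y)"
proof
  assume "subseq [x, y] T"
  then obtain us vs where T: "T = us @ x # vs" and "subseq [y] vs"
    by (auto dest!: list_emb_ConsD)
  then obtain us' vs' where vs: "vs = us' @ y # vs'"
    by (auto dest!: list_emb_ConsD)
  have "length us < length us + 1 + length us' \<and> length us + 1 + length us' < length T \<and>
    T ! length us = x \<and> T ! (length us + 1 + length us') = y"
    by (auto simp: T vs nth_append)
  then show "\<exists>i j. i < j \<and> j < length T \<and> T ! i = x \<and> T ! j = y" by blast
next
  assume "\<exists>i j. i < j \<and> j < length T \<and> T ! i = x \<and> T ! j = y"
  then obtain i j where ij: "i < j" "j < length T" "T ! i = x" "T ! j = y" by blast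
  have "T = take j T @ y # drop (Suc j) T"
    using ij id_take_nth_drop[of j T] by simp
  moreover have "x \<in> set (take j T)"
    using ij by (auto simp: in_set_conv_nth intro!: exI[of _ i])
  moreover have "subseq [x] (take j T)"
    using calculation(2) by (simp add: subseq_singleton_left)
  moreover have "subseq [y] (y # drop (Suc j) T)" by simp
  ultimately show "subseq [x, y] T"
    using list_emb_append_mono[of "(=)" "[x]" "take j T" "[y]" "y # drop (Suc j) T"] by simp
qed

text \<open>Cutting the host word after the first block leaves all further blocks strictly to the
  right, which separates different letters. Two positions inside a block suffice. A letter with
  several blocks is represented by its leftmost one: \<open>?I\<close> and \<open>?J\<close>
  override the induction hypothesis at \<open>x\<close>.\<close>

lemma blocks_positions:
  assumes "subseq (concat (map (\<lambda>(x, d). replicate d x) bs)) S"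
    and "\<forall>(x, d) \<in> set bs. d \<ge> 2"
  shows "\<exists>I J. (\<forall>x \<in> fst ` set bs. 0 < I x \<and> I x < J x \<and> J x \<le> length S \<and>
                 letter S (I x) = x \<and> letter S (J x) = x) \<and>
               (\<forall>x \<in> fst ` set bs. \<forall>y \<in> fst ` set bs. x \<noteq> y \<longrightarrow> J x < I y \<or> J y < (I x :: nat))"
  using assms
proof (induction bs arbitrary: S)
  case (Cons b bs)
  obtain x d where b: "b = (x, d)" by force
  have d: "d \<ge> 2" using Cons.prems b by auto
  obtain S1 S2 where S: "S = S1 @ S2" and S1: "subseq (replicate d x) S1"
    and S2: "subseq (concat (map (\<lambda>(x, d). replicate d x) bs)) S2"
    using Cons.prems(1) b by (auto dest!: list_emb_appendD)
  have "replicate d x = [x, x] @ replicate (d - 2) x"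
    using d by (cases d; cases "d - 1") auto
  then have "subseq [x, x] S1"
    using S1 subseq_order.order_trans[OF prefix_imp_subseq[OF prefixI]] by blast
  then obtain i j where ij: "i < j" "j < length S1" "S1 ! i = x" "S1 ! j = x"
    by (auto simp: subseq_pair_iff)
  obtain I J where IJ: "\<forall>x \<in> fst ` set bs. 0 < I x \<and> I x < J x \<and> J x \<le> length S2 \<and>
                 letter S2 (I x) = x \<and> letter S2 (J x) = x"
    "\<forall>x \<in> fst ` set bs. \<forall>y \<in> fst ` set bs. x \<noteq> y \<longrightarrow> J x < I y \<or> J y < (I x :: nat)"
    using Cons.IH[OF S2] Cons.prems(2) by auto
  let ?I = "\<lambda>y. if y = x then Suc i else length S1 + I y"
  let ?J = "\<lambda>y. if y = x then Suc j else length S1 + J y"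
  \<comment> \<open>Positions count from 1: for \<open>m = 0\<close> the left side would name the
    last letter of \<open>S1\<close>, the right side the first one of \<open>S2\<close>.\<close>
  have shift: "letter S (length S1 + m) = letter S2 m" if "0 < m" for m
    using that by (cases m) (simp_all add: letter_def S nth_append)
  have "\<forall>y \<in> fst ` set (b # bs). 0 < ?I y \<and> ?I y < ?J y \<and> ?J y \<le> length S \<and>
                 letter S (?I y) = y \<and> letter S (?J y) = y"
  proof
    fix y assume y: "y \<in> fst ` set (b # bs)"
    show "0 < ?I y \<and> ?I y < ?J y \<and> ?J y \<le> length S \<and>
                 letter S (?I y) = y \<and> letter S (?J y) = y"
    proof (cases "y = x")
      case True
      then show ?thesis using ij by (auto simp: letter_def S nth_append)
    next
      case False
      then have "y \<in> fst ` set bs" using y b by auto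
      then have *: "0 < I y" "I y < J y" "J y \<le> length S2" "letter S2 (I y) = y" "letter S2 (J y) = y"
        using IJ(1) by auto
      then have "0 < J y" by simp
      then show ?thesis using * False shift[of "I y"] shift[of "J y"] by (simp add: S)
    qed
  qed
  moreover have "\<forall>y \<in> fst ` set (b # bs). \<forall>z \<in> fst ` set (b # bs). y \<noteq> z \<longrightarrow>
      ?J y < ?I z \<or> ?J z < ?I y"
  proof (intro ballI impI)
    fix y z assume yz: "y \<in> fst ` set (b # bs)" "z \<in> fst ` set (b # bs)" "y \<noteq> z"
    have "y = x \<or> y \<in> fst ` set bs" "z = x \<or> z \<in> fst ` set bs" using yz b by auto
    then show "?J y < ?I z \<or> ?J z < ?I y"
      using IJ(1)[rule_format, of y] IJ(1)[rule_format, of z] IJ(2)[rule_format, of y z] yz(3) ij(2)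
      by (cases "y = x"; cases "z = x") auto
  qed
  ultimately show ?case by (rule exI[of _ ?J, THEN exI[of _ ?I], OF conjI])
qed simp

text \<open>Induction on the largest right end \<open>b\<close>: every other interval ends before
  \<open>b\<close> and is disjoint from that of \<open>b\<close>, so it ends before
  \<open>prv S b\<close>. The induction hypothesis is used for the prefix of length
  \<open>prv S b - 1\<close>, for which \<open>m\<close> is kept arbitrary, and the block of
  \<open>b\<close> is appended.\<close>

lemma valid_imp_blocks:
  assumes "finite C" "C \<subseteq> right_ends S" "inj_on (letter S) C"
    "\<forall>d\<in>C. \<forall>e\<in>C. d \<noteq> e \<longrightarrow> ival S d \<inter> ival S e = {}" "\<forall>e\<in>C. e \<le> m"
  shows "\<exists>xs. distinct xs \<and> set xs = letter S ` C \<and> subseq (concat (map (\<lambda>x. [x, x]) xs)) (take m S)"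
  using assms
proof (induction C arbitrary: m rule: finite_linorder_max_induct)
  case (insert b C)
  let ?p = "prv S b" and ?x = "letter S b"
  have b: "0 < ?p" "?p < b" "b \<le> length S" using insert.prems(1) right_endsD by auto
  have "e \<le> ?p - 1" if "e \<in> C" for e
  proof -
    have eb: "e < b" using insert.hyps that by blast
    have "e \<in> ival S e" using that insert.prems(1) by (intro right_end_in_ival) auto
    moreover have "ival S e \<inter> ival S b = {}" using insert.prems(3) that eb by auto
    ultimately have "e \<notin> ival S b" by auto
    then show ?thesis using eb by (auto simp: ival_def)
  qed
  then obtain xs where xs: "distinct xs" "set xs = letter S ` C"
    "subseq (concat (map (\<lambda>x. [x, x]) xs)) (take (?p - 1) S)"
    using insert.IH[of "?p - 1"] insert.prems by (auto simp: inj_on_def)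
  have "b \<le> m" using insert.prems by auto
  then have "take m S = take (?p - 1) S @ drop (?p - 1) (take m S)"
    using b append_take_drop_id[of "?p - 1" "take m S"] by (auto simp: min_def split: if_splits)
  moreover have "subseq [?x, ?x] (drop (?p - 1) (take m S))"
  proof -
    have nth: "drop (?p - 1) (take m S) ! i = S ! (?p - 1 + i)" if "?p - 1 + i < m" for i
      using that b by (subst nth_drop) auto
    have "?p - 1 + 0 < m" "?p - 1 + (b - ?p) < m" "?p - 1 + (b - ?p) = b - 1"
      using b \<open>b \<le> m\<close> by auto
    then have "drop (?p - 1) (take m S) ! 0 = ?x" "drop (?p - 1) (take m S) ! (b - ?p) = ?x"
      using prv_letter[OF b(1)] by (simp_all only: nth add_0_right letter_def)
    moreover have "0 < b - ?p" "b - ?p < length (drop (?p - 1) (take m S))"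
      using b \<open>b \<le> m\<close> by auto
    ultimately have "0 < b - ?p \<and> b - ?p < length (drop (?p - 1) (take m S)) \<and>
        drop (?p - 1) (take m S) ! 0 = ?x \<and> drop (?p - 1) (take m S) ! (b - ?p) = ?x" by blast
    then show ?thesis unfolding subseq_pair_iff by blast
  qed
  ultimately have "subseq (concat (map (\<lambda>x. [x, x]) xs) @ [?x, ?x]) (take m S)"
    using list_emb_append_mono[OF xs(3)] by metis
  then have "subseq (concat (map (\<lambda>x. [x, x]) (xs @ [?x]))) (take m S)" by simp
  moreover have "b \<notin> C" using insert.hyps by auto
  then have "?x \<notin> set xs" using insert.prems(2) xs(2) by (auto simp: inj_on_def)
  ultimately show ?case using xs by (intro exI[of _ "xs @ [?x]"]) auto
qed auto

text \<open>Each letter keeps only the right end \<open>J x\<close> of a pair inside one of its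
  blocks. Conversely, every interval becomes a block of length 2; the letters of these blocks are
  distinct, so neighbours differ.\<close>

lemma FT_solvable_iff_valid:
  "FT_solvable (\<sigma>, S) \<longleftrightarrow> (\<exists>C. valid S C {..<\<sigma>})"
proof
  assume "FT_solvable (\<sigma>, S)"
  then obtain w where "subseq w S" "letter_duplicated {..<\<sigma>} w" and w: "{..<\<sigma>} \<subseteq> set w"
    by (auto simp: FT_solvable_def is_LDS_def)
  then obtain bs where bs: "w = concat (map (\<lambda>(x, d). replicate d x) bs)"
    "\<forall>i < length bs. fst (bs ! i) \<in> {..<\<sigma>} \<and> snd (bs ! i) \<ge> 2"
    by (auto simp: letter_duplicated_def)
  have "\<forall>(x, d) \<in> set bs. d \<ge> 2" using bs(2) by (fastforce simp: in_set_conv_nth)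
  with blocks_positions[of bs S] \<open>subseq w S\<close> bs(1)
  obtain I J where IJ: "\<forall>x \<in> fst ` set bs. 0 < I x \<and> I x < J x \<and> J x \<le> length S \<and>
                 letter S (I x) = x \<and> letter S (J x) = x"
    "\<forall>x \<in> fst ` set bs. \<forall>y \<in> fst ` set bs. x \<noteq> y \<longrightarrow> J x < I y \<or> J y < (I x :: nat)"
    by blast
  have sub: "{..<\<sigma>} \<subseteq> fst ` set bs"
  proof
    fix x assume "x \<in> {..<\<sigma>}"
    then obtain b where "b \<in> set bs" "x \<in> set ((\<lambda>(x, d). replicate d x) b)"
      using w bs(1) by auto
    then show "x \<in> fst ` set bs" by (cases b) (auto intro: rev_image_eqI)
  qed
  have *: "0 < I x" "I x < J x" "J x \<le> length S" "letter S (I x) = x" "letter S (J x) = x"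
    if "x < \<sigma>" for x using IJ(1) sub that by auto
  \<comment> \<open>Moving the left end up to the occurrence just before \<open>J x\<close> only
    shrinks the interval, so disjointness survives.\<close>
  have le: "I x \<le> prv S (J x)" if "x < \<sigma>" for x
    using *[OF that] by (intro prv_greatest) auto
  have "valid S (J ` {..<\<sigma>}) {..<\<sigma>}"
    unfolding valid_def
  proof (intro conjI ballI impI)
    show "J ` {..<\<sigma>} \<subseteq> right_ends S"
      using *(1,3) le by (auto simp: right_ends_def intro: less_le_trans)
    show "inj_on (letter S) (J ` {..<\<sigma>})" "letter S ` J ` {..<\<sigma>} = {..<\<sigma>}"
      using *(5) by (auto simp: inj_on_def image_iff)
  next
    fix d e assume "d \<in> J ` {..<\<sigma>}" "e \<in> J ` {..<\<sigma>}" "d \<noteq> e"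
    then obtain x y where xy: "d = J x" "e = J y" "x \<noteq> y" "x < \<sigma>" "y < \<sigma>" by auto
    then have "x \<in> fst ` set bs" "y \<in> fst ` set bs" using sub by auto
    then have "J x < I y \<or> J y < I x" using IJ(2)[rule_format] xy(3) by iprover
    then show "ival S d \<inter> ival S e = {}"
      using xy le[of x] le[of y] by (auto simp: ival_def)
  qed
  then show "\<exists>C. valid S C {..<\<sigma>}" by blast
next
  assume "\<exists>C. valid S C {..<\<sigma>}"
  then obtain C where C: "valid S C {..<\<sigma>}" by blast
  then have "C \<subseteq> {..length S}" by (auto simp: valid_def right_ends_def)
  then have "finite C" "\<forall>e\<in>C. e \<le> length S" using finite_subset by auto
  with C obtain xs where xs: "distinct xs" "set xs = {..<\<sigma>}"
    "subseq (concat (map (\<lambda>x. [x, x]) xs)) S"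
    using valid_imp_blocks[of C S "length S"] by (auto simp: valid_def)
  let ?bs = "map (\<lambda>x. (x, 2 :: nat)) xs"
  have eq: "concat (map (\<lambda>x. [x, x]) xs) = concat (map (\<lambda>(x, d). replicate d x) ?bs)"
    by (simp add: comp_def numeral_2_eq_2)
  have "letter_duplicated {..<\<sigma>} (concat (map (\<lambda>x. [x, x]) xs))"
    unfolding letter_duplicated_def
  proof (intro exI[of _ ?bs] conjI)
    show "concat (map (\<lambda>x. [x, x]) xs) = concat (map (\<lambda>(x, d). replicate d x) ?bs)" by (fact eq)
    show "\<forall>i < length ?bs. fst (?bs ! i) \<in> {..<\<sigma>} \<and> snd (?bs ! i) \<ge> 2"
      using xs(2) nth_mem[of _ xs] by auto
    show "\<forall>j. Suc j < length ?bs \<longrightarrow> fst (?bs ! j) \<noteq> fst (?bs ! Suc j)"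
      using xs(1) by (simp add: nth_eq_iff_index_eq)
  qed
  then show "FT_solvable (\<sigma>, S)"
    using xs unfolding FT_solvable_def is_LDS_def by auto
qed

section \<open>The at most two intervals of a letter\<close>

definition options :: "'a list \<Rightarrow> 'a \<Rightarrow> nat set" where
  "options S a = {e \<in> right_ends S. letter S e = a}"

lemma count_list_eq_card: "count_list S a = card {j. 0 < j \<and> j \<le> length S \<and> letter S j = a}"
proof -
  have "{j. 0 < j \<and> j \<le> length S \<and> letter S j = a} = Suc ` {i. i < length S \<and> S ! i = a}"
  proof (intro set_eqI iffI)
    fix j assume "j \<in> {j. 0 < j \<and> j \<le> length S \<and> letter S j = a}"
    then show "j \<in> Suc ` {i. i < length S \<and> S ! i = a}"
      by (cases j) (auto simp: letter_def)
  qed (auto simp: letter_def)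
  then show ?thesis
    by (simp add: card_image count_list_eq_length_filter length_filter_conv_card eq_commute[of a])
qed

text \<open>Three different right ends and the predecessor of the leftmost of them would be four
  occurrences.\<close>

lemma options_at_most_two:
  assumes "count_list S a \<le> 3" "{e1, e2, e3} \<subseteq> options S a"
  shows "e1 = e2 \<or> e1 = e3 \<or> e2 = e3"
proof (rule ccontr)
  assume neg: "\<not> ?thesis"
  let ?P = "{j. 0 < j \<and> j \<le> length S \<and> letter S j = a}"
  define m where "m = Min {e1, e2, e3}"
  have m: "m \<in> {e1, e2, e3}" unfolding m_def by (rule Min_in) auto
  then have "m \<in> options S a" using assms(2) by blast
  then have p: "0 < prv S m" "prv S m < m" "letter S m = a" "m \<le> length S"
    using right_endsD[of m S] by (auto simp: options_def)
  have le: "m \<le> e1" "m \<le> e2" "m \<le> e3" unfolding m_def by auto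
  have "{prv S m, e1, e2, e3} \<subseteq> ?P"
    using assms(2) p prv_letter[of S m] right_endsD(3,4)[of _ S] by (auto simp: options_def)
  moreover have "finite ?P" by (rule finite_subset[of _ "{..length S}"]) auto
  ultimately have "card {prv S m, e1, e2, e3} \<le> card ?P" by (rule card_mono[rotated])
  moreover have "card {prv S m, e1, e2, e3} = 4" using neg le p(2) by auto
  ultimately show False using assms(1) by (simp add: count_list_eq_card)
qed

text \<open>The first occurrence after \<open>k\<close> has \<open>k\<close> as its predecessor. In
  \<open>other_option\<close> this makes the value 0 of \<open>nx\<close> conclusive: no later
  position carries the letter.\<close>

lemma next_occ_exists:
  assumes "0 < k" "k < l" "letter S k = letter S l"
  shows "\<exists>j\<le>l. prv S j = k"
proof -
  define j where "j = (LEAST j. k < j \<and> letter S j = letter S k)"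
  have j: "k < j" "letter S j = letter S k" and "j \<le> l"
    using LeastI[of "\<lambda>j. k < j \<and> letter S j = letter S k" l] assms
      Least_le[of "\<lambda>j. k < j \<and> letter S j = letter S k" l] unfolding j_def by auto
  have "k \<le> prv S j" using j assms(1) by (intro prv_greatest) auto
  moreover have "\<not> k < prv S j"
  proof
    assume "k < prv S j"
    moreover have "prv S j < j" "letter S (prv S j) = letter S j"
      using calculation by (auto intro!: prv_less prv_letter)
    ultimately show False
      using not_less_Least[of "prv S j" "\<lambda>j. k < j \<and> letter S j = letter S k"] j
      unfolding j_def[symmetric] by auto
  qed
  ultimately show ?thesis using \<open>j \<le> l\<close> by (intro exI[of _ j]) auto
qed

text \<open>Of occurrences \<open>p < q < r\<close> only \<open>q\<close> and \<open>r\<close> are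
  right ends. If the predecessor of \<open>e\<close> has a predecessor, then \<open>e\<close> is
  \<open>r\<close> and the alternative is \<open>prv S e\<close>; otherwise \<open>e\<close> is
  \<open>q\<close> and the alternative is the next occurrence \<open>nx\<close>, with 0 for none. So
  the flip is a lookup of constant cost.\<close>

lemma other_option:
  assumes cnt: "count_list S (letter S e) \<le> 3"
    and e: "e \<in> right_ends S"
    and nxt: "\<And>j. 0 < j \<Longrightarrow> nx = j \<longleftrightarrow> j \<le> length S \<and> prv S j = e"
    and y: "y = (if prv S (prv S e) > 0 then prv S e else nx)"
  shows "options S (letter S e) = (if y > 0 then {e, y} else {e}) \<and> y \<noteq> e"
proof -
  let ?O = "options S (letter S e)"
  note d = right_endsD[OF e]
  have eO: "e \<in> ?O" using e by (simp add: options_def)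
  have *: "?O = {e, y}" if "y \<in> ?O" "y \<noteq> e"
    using that eO options_at_most_two[OF cnt, of e y] by blast
  show ?thesis
  proof (cases "prv S (prv S e) > 0")
    case True
    then have "y = prv S e" using y by simp
    then show ?thesis using True * d prv_letter[of S e] by (auto simp: options_def right_ends_def)
  next
    case False
    then have "y = nx" using y by simp
    show ?thesis
    proof (cases "nx > 0")
      case True
      then have "prv S nx = e" "nx \<le> length S" using nxt by auto
      then have "nx \<in> ?O" "nx \<noteq> e"
        using d prv_letter[of S nx] prv_less[of S nx] by (auto simp: options_def right_ends_def)
      then show ?thesis using * \<open>y = nx\<close> True by auto
    next
      case nx: False
      have "l = e" if "l \<in> ?O" for l
      proof (rule ccontr)
        assume "l \<noteq> e"
        have l: "l \<in> right_ends S" "letter S l = letter S e" using that by (auto simp: options_def)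
        note dl = right_endsD[OF l(1)]
        show False
        proof (cases "l < e")
          case True
          \<comment> \<open>An option left of \<open>e\<close> would give \<open>prv S e\<close> a
            predecessor, against the case assumption.\<close>
          then have "l \<le> prv S e" using l dl by (intro prv_greatest) auto
          moreover have "prv S l \<le> prv S (prv S e)"
          proof (cases "l = prv S e")
            case False
            then have "l \<le> prv S (prv S e)" using calculation dl l d prv_letter[of S e]
              by (intro prv_greatest) auto
            then show ?thesis using dl by simp
          qed simp
          ultimately show False using dl False by simp
        next
          case False
          then obtain j where j: "j \<le> l" "prv S j = e"
            using next_occ_exists[of e l S] d l \<open>l \<noteq> e\<close> by auto
          then have "0 < j" using d by (cases j) auto
          then show False using nxt[of j] nx j dl by auto
        qed
      qed
      then have "?O = {e}" using eO by blast
      then show ?thesis using nx \<open>y = nx\<close> d by auto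
    qed
  qed
qed

text \<open>Of two positions with the same predecessor, the smaller would be a later occurrence
  still before the larger. Hence one write per position suffices to fill \<open>Nxt\<close>.\<close>

lemma prv_inj:
  assumes "prv S j = prv S l" "0 < prv S j"
  shows "j = l"
proof (rule ccontr)
  assume "j \<noteq> l"
  have *: False if "i < k" "prv S i = prv S k" "0 < prv S i" for i k
  proof -
    have "letter S i = letter S k" using prv_letter[of S i] prv_letter[of S k] that by simp
    moreover have "prv S i < i" using prv_less that by blast
    ultimately have "i \<le> prv S k" using prv_greatest[of i k S] that by simp
    then show False using \<open>prv S i < i\<close> that by simp
  qed
  show False using *[of j l] *[of l j] assms \<open>j \<noteq> l\<close> by (cases "j < l") auto
qed

text \<open>These are the two candidates that the program tries. A further option would be a third
  right end beside \<open>l\<close> and \<open>prv S l\<close>. The inclusion may be strict, as a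
  letter may occur once or not at all.\<close>

lemma options_subset:
  assumes "count_list S a \<le> 3" "l = last_occ S a (length S)"
  shows "options S a \<subseteq> {l, prv S l}"
proof
  fix e assume e: "e \<in> options S a"
  then have er: "e \<in> right_ends S" "letter S e = a" by (auto simp: options_def)
  note d = right_endsD[OF er(1)]
  have el: "e \<le> l" using d er assms(2) by (simp add: last_occ_greatest)
  then have l: "letter S l = a" "l \<le> length S" using d assms(2) last_occ_letter[of S a "length S"] last_occ_le by auto
  show "e \<in> {l, prv S l}"
  proof (rule ccontr)
    assume neg: "e \<notin> {l, prv S l}"
    then have "e \<le> prv S l" using el d er l by (intro prv_greatest) auto
    then have lt: "e < prv S l" using neg by simp
    then have p: "letter S (prv S l) = a" "prv S l < l" using l prv_letter[of S l] prv_less[of S l] by auto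
    have "e \<le> prv S (prv S l)" using lt d er p by (intro prv_greatest) auto
    then have "{e, prv S l, l} \<subseteq> options S a"
      using e d p l lt by (auto simp: options_def right_ends_def)
    from options_at_most_two[OF assms(1) this] show False using lt p by auto
  qed
qed

section \<open>Inserting one letter\<close>

text \<open>Only positive \<open>e\<close> are quantified over, so that 0 is left for positions
  covered by no interval; entries outside the string are unconstrained.\<close>

definition owns :: "'a list \<Rightarrow> nat set \<Rightarrow> (nat \<Rightarrow> nat) \<Rightarrow> bool" where
  "owns S C own \<longleftrightarrow> (\<forall>k\<in>{1..length S}. \<forall>e>0. own k = e \<longleftrightarrow> e \<in> C \<and> k \<in> ival S e)"

lemma ownsD: "owns S C own \<Longrightarrow> k \<in> {1..length S} \<Longrightarrow> 0 < e \<Longrightarrow> own k = e \<longleftrightarrow> e \<in> C \<and> k \<in> ival S e"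
  by (simp add: owns_def)

text \<open>Larger \<open>B'\<close> are admitted in order that exclusion carry over to the full alphabet.\<close>

definition excluded :: "'a list \<Rightarrow> 'a set \<Rightarrow> nat \<Rightarrow> bool" where
  "excluded S B e \<longleftrightarrow> (\<forall>C' B'. valid S C' B' \<longrightarrow> B \<subseteq> B' \<longrightarrow> e \<notin> C')"

locale insertion =
  fixes S :: "'a list" and C :: "nat set" and B :: "'a set" and e0 :: nat and own :: "nat \<Rightarrow> nat"
  assumes valid_C: "valid S C B" and e0_end: "e0 \<in> right_ends S" and e0_new: "letter S e0 \<notin> B"
    and owns_C: "owns S C own"
begin

text \<open>\<open>ds\<close> is the queue of intervals to be claimed. Those before index \<open>h\<close> are claimed
  completely, and of the current one \<open>ds ! h\<close> the positions from \<open>m\<close> onwards are. \<open>new\<close> maps a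
  position to the queued interval that has claimed it, and \<open>fl\<close> marks the intervals of \<open>C\<close> whose
  letters have flipped. The last clause says that all flips are forced.\<close>

definition trial :: "nat list \<Rightarrow> nat \<Rightarrow> nat \<Rightarrow> (nat \<Rightarrow> nat) \<Rightarrow> (nat \<Rightarrow> nat) \<Rightarrow> bool" where
  "trial ds h m new fl \<longleftrightarrow>
     h < length ds \<and> prv S (ds ! h) \<le> m \<and> m \<le> Suc (ds ! h) \<and>
     distinct ds \<and> e0 \<in> set ds \<and> set ds \<subseteq> right_ends S \<and> inj_on (letter S) (set ds) \<and>
     (\<forall>d\<in>set ds. d = e0 \<or> (\<exists>r\<in>C. fl r > 0 \<and> letter S d = letter S r \<and> d \<noteq> r)) \<and>
     (\<forall>r\<in>C. fl r > 0 \<longrightarrow> letter S r \<in> letter S ` set ds) \<and>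
     (\<forall>j\<in>{1..length S}. \<forall>d>0. new j = d \<longleftrightarrow>
        j \<in> ival S d \<and> (d \<in> set (take h ds) \<or> d = ds ! h \<and> m \<le> j)) \<and>
     (\<forall>j\<in>{1..length S}. new j > 0 \<longrightarrow> own j > 0 \<longrightarrow> fl (own j) > 0) \<and>
     (\<forall>C' B'. valid S C' B' \<longrightarrow> B \<subseteq> B' \<longrightarrow> e0 \<in> C' \<longrightarrow> set ds \<subseteq> C')"

lemma trialD:
  assumes "trial ds h m new fl"
  shows "h < length ds" "prv S (ds ! h) \<le> m" "m \<le> Suc (ds ! h)" "distinct ds" "e0 \<in> set ds"
    "set ds \<subseteq> right_ends S" "inj_on (letter S) (set ds)"
    "\<And>d. d \<in> set ds \<Longrightarrow> d = e0 \<or> (\<exists>r\<in>C. fl r > 0 \<and> letter S d = letter S r \<and> d \<noteq> r)"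
    "\<And>r. r \<in> C \<Longrightarrow> fl r > 0 \<Longrightarrow> letter S r \<in> letter S ` set ds"
    "\<And>j d. j \<in> {1..length S} \<Longrightarrow> d > 0 \<Longrightarrow> new j = d \<longleftrightarrow>
        j \<in> ival S d \<and> (d \<in> set (take h ds) \<or> d = ds ! h \<and> m \<le> j)"
    "\<And>j. j \<in> {1..length S} \<Longrightarrow> new j > 0 \<Longrightarrow> own j > 0 \<Longrightarrow> fl (own j) > 0"
    "\<And>C' B'. valid S C' B' \<Longrightarrow> B \<subseteq> B' \<Longrightarrow> e0 \<in> C' \<Longrightarrow> set ds \<subseteq> C'"
proof -
  note c1 = assms[unfolded trial_def]
  note c2 = c1[THEN conjunct2] note c3 = c2[THEN conjunct2] note c4 = c3[THEN conjunct2]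
  note c5 = c4[THEN conjunct2] note c6 = c5[THEN conjunct2] note c7 = c6[THEN conjunct2]
  note c8 = c7[THEN conjunct2] note c9 = c8[THEN conjunct2] note c10 = c9[THEN conjunct2]
  note c11 = c10[THEN conjunct2]
  note l = c1[THEN conjunct1] c2[THEN conjunct1] c3[THEN conjunct1] c4[THEN conjunct1]
    c5[THEN conjunct1] c6[THEN conjunct1] c7[THEN conjunct1] c8[THEN conjunct1, rule_format]
    c9[THEN conjunct1, rule_format] c10[THEN conjunct1, rule_format]
    c11[THEN conjunct1, rule_format] c11[THEN conjunct2, rule_format]
  show "h < length ds" "prv S (ds ! h) \<le> m" "m \<le> Suc (ds ! h)" "distinct ds" "e0 \<in> set ds"
    "set ds \<subseteq> right_ends S" "inj_on (letter S) (set ds)" by (fact l(1-7))+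
  show "\<And>d. d \<in> set ds \<Longrightarrow> d = e0 \<or> (\<exists>r\<in>C. fl r > 0 \<and> letter S d = letter S r \<and> d \<noteq> r)" by (rule l(8))
  show "\<And>r. r \<in> C \<Longrightarrow> fl r > 0 \<Longrightarrow> letter S r \<in> letter S ` set ds" by (rule l(9))
  show "\<And>j d. j \<in> {1..length S} \<Longrightarrow> d > 0 \<Longrightarrow> new j = d \<longleftrightarrow>
        j \<in> ival S d \<and> (d \<in> set (take h ds) \<or> d = ds ! h \<and> m \<le> j)" by (rule l(10))
  show "\<And>j. j \<in> {1..length S} \<Longrightarrow> new j > 0 \<Longrightarrow> own j > 0 \<Longrightarrow> fl (own j) > 0" by (rule l(11))
  show "\<And>C' B'. valid S C' B' \<Longrightarrow> B \<subseteq> B' \<Longrightarrow> e0 \<in> C' \<Longrightarrow> set ds \<subseteq> C'" by (rule l(12))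
qed

lemma trialI:
  assumes "h < length ds" "prv S (ds ! h) \<le> m" "m \<le> Suc (ds ! h)" "distinct ds" "e0 \<in> set ds"
    "set ds \<subseteq> right_ends S" "inj_on (letter S) (set ds)"
    "\<And>d. d \<in> set ds \<Longrightarrow> d = e0 \<or> (\<exists>r\<in>C. fl r > 0 \<and> letter S d = letter S r \<and> d \<noteq> r)"
    "\<And>r. r \<in> C \<Longrightarrow> fl r > 0 \<Longrightarrow> letter S r \<in> letter S ` set ds"
    "\<And>j d. j \<in> {1..length S} \<Longrightarrow> d > 0 \<Longrightarrow> new j = d \<longleftrightarrow>
        j \<in> ival S d \<and> (d \<in> set (take h ds) \<or> d = ds ! h \<and> m \<le> j)"
    "\<And>j. j \<in> {1..length S} \<Longrightarrow> new j > 0 \<Longrightarrow> own j > 0 \<Longrightarrow> fl (own j) > 0"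
    "\<And>C' B'. valid S C' B' \<Longrightarrow> B \<subseteq> B' \<Longrightarrow> e0 \<in> C' \<Longrightarrow> set ds \<subseteq> C'"
  shows "trial ds h m new fl"
  unfolding trial_def by (intro conjI ballI allI impI) (fact assms)+

lemma C_simps: "C \<subseteq> right_ends S" "inj_on (letter S) C" "letter S ` C = B"
  "d \<in> C \<Longrightarrow> e \<in> C \<Longrightarrow> d \<noteq> e \<Longrightarrow> ival S d \<inter> ival S e = {}"
  using valid_C by (auto simp: valid_def)

text \<open>Positions are claimed from the right end downwards, so the limit \<open>Suc e0\<close>
  says that nothing has been claimed yet.\<close>

lemma trial_init:
  assumes "\<forall>j\<in>{1..length S}. new j = 0" "\<forall>j\<in>{1..length S}. fl j = 0"
  shows "trial [e0] 0 (Suc e0) new fl"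
proof -
  have "fl r = 0" if "r \<in> C" for r
    using that C_simps(1) right_endsD[of r S] assms(2) by auto
  moreover have "j \<notin> ival S d \<or> d \<noteq> e0 \<or> \<not> Suc e0 \<le> j" for j d
    by (auto simp: ival_def)
  ultimately show ?thesis
    using assms(1) e0_end right_endsD(2)[OF e0_end] unfolding trial_def by auto
qed

text \<open>For the third fact: the letter of \<open>e0\<close> is outside \<open>B\<close>, and any
  other queued interval differs from the interval of \<open>C\<close> with the same letter, which is
  unique.\<close>

lemma current_end:
  assumes "trial ds h m new fl"
  shows "ds ! h \<in> set ds" "ds ! h \<in> right_ends S" "ds ! h \<notin> C" "0 < ds ! h"
proof -
  note I = trialD[OF assms]
  show d: "ds ! h \<in> set ds" using I(1) by simp
  show r: "ds ! h \<in> right_ends S" using d I(6) by blast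
  show "0 < ds ! h" using right_endsD[OF r] by simp
  show "ds ! h \<notin> C"
  proof
    assume dC: "ds ! h \<in> C"
    consider "ds ! h = e0" | r where "r \<in> C" "letter S (ds ! h) = letter S r" "ds ! h \<noteq> r"
      using I(8)[OF d] by blast
    then show False
    proof cases
      case 1
      then show False using dC e0_new C_simps(3) by auto
    next
      case 2
      then show False using dC C_simps(2) by (auto simp: inj_on_def)
    qed
  qed
qed

text \<open>Both the current interval and the earlier claimant of \<open>k\<close> are forced, and
  they share \<open>k\<close>. They differ, since the limit \<open>Suc k\<close> shows that the
  current interval has not reached \<open>k\<close> and the queue has no repetitions.\<close>

lemma conflict_excluded:
  assumes trial: "trial ds h (Suc k) new fl" and k: "k \<in> ival S (ds ! h)" and new: "new k > 0"
  shows "excluded S B e0"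
  unfolding excluded_def
proof (intro allI impI notI)
  fix C' B' assume C': "valid S C' B'" "B \<subseteq> B'" "e0 \<in> C'"
  note I = trialD[OF trial] and c = current_end[OF trial]
  have kS: "k \<in> {1..length S}" using k ival_subset[OF c(2)] by blast
  have d: "k \<in> ival S (new k)" "new k \<in> set (take h ds)"
    using I(10)[OF kS new] by auto
  have "ds ! h \<notin> set (take h ds)"
    using I(1,4) by (auto simp: in_set_conv_nth nth_eq_iff_index_eq)
  then have ne: "new k \<noteq> ds ! h" using d(2) by auto
  have "new k \<in> C'" "ds ! h \<in> C'" using I(12)[OF C'] d(2) c(1) by (auto dest: in_set_takeD)
  then show False using C'(1) ne d(1) k unfolding valid_def by blast
qed

text \<open>A solution through \<open>e0\<close> contains the current interval, which meets
  \<open>r\<close> in \<open>k\<close>, so it cannot contain \<open>r\<close>. It still has to serve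
  the letter of \<open>r\<close>, because \<open>B \<subseteq> B'\<close>, and must do so by another
  interval.\<close>

lemma owner_displaced:
  assumes trial: "trial ds h (Suc k) new fl" and k: "k \<in> ival S (ds ! h)" and r: "own k = r" "r > 0"
    and C': "valid S C' B'" "B \<subseteq> B'" "e0 \<in> C'"
  shows "\<exists>e\<in>C'. e \<in> options S (letter S r) \<and> e \<noteq> r"
proof -
  note I = trialD[OF trial] and c = current_end[OF trial]
  have kS: "k \<in> {1..length S}" using k ival_subset[OF c(2)] by blast
  have oC: "r \<in> C" "k \<in> ival S r" using ownsD[OF owns_C kS r(2)] r(1) by auto
  have "letter S r \<in> letter S ` C'" using oC(1) C_simps(3) C' unfolding valid_def by blast
  then obtain e where e: "e \<in> C'" "letter S e = letter S r" by auto
  have "ds ! h \<in> C'" using I(12)[OF C'] c(1) by blast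
  moreover have "ds ! h \<noteq> r" using c(3) oC(1) by blast
  ultimately have "r \<notin> C'" using C'(1) k oC(2) unfolding valid_def by blast
  then have "e \<noteq> r" using e(1) by blast
  moreover have "e \<in> right_ends S" using e(1) C'(1) unfolding valid_def by blast
  ultimately show ?thesis using e by (auto simp: options_def)
qed

lemma stuck_excluded:
  assumes "trial ds h (Suc k) new fl" "k \<in> ival S (ds ! h)" "own k = r" "r > 0"
    and "options S (letter S r) = {r}"
  shows "excluded S B e0"
  unfolding excluded_def using owner_displaced[OF assms(1-4)] assms(5) by blast

lemma claim_new:
  assumes trial: "trial ds h (Suc k) new fl" and k: "k \<in> ival S (ds ! h)" and new: "new k = 0"
    and j: "j \<in> {1..length S}" and d: "d > 0"
  shows "(new(k := ds ! h)) j = d \<longleftrightarrow> j \<in> ival S d \<and> (d \<in> set (take h ds) \<or> d = ds ! h \<and> k \<le> j)"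
proof (cases "j = k")
  case True
  then show ?thesis
    using trialD(10)[OF trial j d] new d k current_end(4)[OF trial] by auto
next
  case False
  then have "Suc k \<le> j \<longleftrightarrow> k \<le> j" by auto
  then show ?thesis using trialD(10)[OF trial j d] False by simp
qed

lemma trial_claim:
  assumes trial: "trial ds h (Suc k) new fl" and k: "k \<in> ival S (ds ! h)" and new: "new k = 0"
    and own: "own k = 0 \<or> fl (own k) > 0"
  shows "trial ds h k (new(k := ds ! h)) fl"
proof -
  note I = trialD[OF trial]
  have m: "prv S (ds ! h) \<le> k" "k \<le> Suc (ds ! h)" using k by (auto simp: ival_def)
  have fl: "fl (own j) > 0" if "j \<in> {1..length S}" "(new(k := ds ! h)) j > 0" "own j > 0" for j
    using that I(11)[of j] own by (cases "j = k") auto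
  show ?thesis by (rule trialI) (fact I m claim_new[OF trial k new] fl)+
qed

text \<open>Because \<open>r\<close> is unmarked and its letter is not that of \<open>e0\<close>, no
  queued interval has this letter yet; so the queue stays injective on letters after appending
  \<open>y\<close>. That \<open>y\<close> is forced is \<open>owner_displaced\<close> with only two
  options available.\<close>

lemma trial_claim_flip:
  assumes trial: "trial ds h (Suc k) new fl" and k: "k \<in> ival S (ds ! h)" and new: "new k = 0"
    and r: "own k = r" "r > 0" "fl r = 0" and y: "options S (letter S r) = {r, y}" "y \<noteq> r"
  shows "trial (ds @ [y]) h k (new(k := ds ! h)) (fl(r := 1))"
proof -
  note I = trialD[OF trial] and c = current_end[OF trial]
  have kS: "k \<in> {1..length S}" using k ival_subset[OF c(2)] by blast
  have oC: "r \<in> C" "k \<in> ival S r" using ownsD[OF owns_C kS r(2)] r(1) by auto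
  have m: "prv S (ds ! h) \<le> k" "k \<le> Suc (ds ! h)" using k by (auto simp: ival_def)
  have "y \<in> options S (letter S r)" using y(1) by simp
  then have yl: "letter S y = letter S r" "y \<in> right_ends S" by (auto simp: options_def)
  have fresh: "letter S d \<noteq> letter S y" if d: "d \<in> set ds" for d
  proof
    assume l: "letter S d = letter S y"
    consider "d = e0" | r' where "r' \<in> C" "fl r' > 0" "letter S d = letter S r'"
      using I(8)[OF d] by blast
    then show False
    proof cases
      case 1
      then show False using l yl(1) oC(1) e0_new C_simps(3) by auto
    next
      case 2
      then have "r' = r" using l yl(1) oC(1) C_simps(2) by (auto simp: inj_on_def)
      then show False using 2(2) r(3) by simp
    qed
  qed
  have nth: "(ds @ [y]) ! h = ds ! h" "take h (ds @ [y]) = take h ds"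
    using I(1) by (simp_all add: nth_append)
  have new_ds: "h < length (ds @ [y])" "e0 \<in> set (ds @ [y])" "set (ds @ [y]) \<subseteq> right_ends S"
    "distinct (ds @ [y])" "inj_on (letter S) (set (ds @ [y]))"
    using I(1,4-7) yl(2) fresh fresh[symmetric] by auto
  have orig: "d = e0 \<or> (\<exists>r'\<in>C. (fl(r := 1)) r' > 0 \<and> letter S d = letter S r' \<and> d \<noteq> r')"
    if "d \<in> set (ds @ [y])" for d
  proof (cases "d = y")
    case True
    then show ?thesis using oC(1) yl(1) y(2) by (intro disjI2 bexI[of _ r]) auto
  next
    case False
    then have "d \<in> set ds" using that by auto
    from I(8)[OF this] show ?thesis by auto
  qed
  have kept: "letter S r' \<in> letter S ` set (ds @ [y])" if "r' \<in> C" "(fl(r := 1)) r' > 0" for r'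
    using that I(9)[of r'] yl(1) by (cases "r' = r") auto
  have fl: "(fl(r := 1)) (own j) > 0"
    if "j \<in> {1..length S}" "(new(k := ds ! h)) j > 0" "own j > 0" for j
    using that I(11)[of j] r(1) by (cases "j = k") auto
  have forced: "set (ds @ [y]) \<subseteq> C'" if "valid S C' B'" "B \<subseteq> B'" "e0 \<in> C'" for C' B'
    using owner_displaced[OF trial k r(1,2) that] y(1) I(12)[OF that] by auto
  show ?thesis
    by (rule trialI, unfold nth) (fact m new_ds orig kept claim_new[OF trial k new] fl forced)+
qed

lemma trial_advance:
  assumes trial: "trial ds h (prv S (ds ! h)) new fl" and h: "Suc h < length ds"
  shows "trial ds (Suc h) (Suc (ds ! Suc h)) new fl"
proof -
  note I = trialD[OF trial]
  have "ds ! Suc h \<in> right_ends S" using h I(6) nth_mem by blast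
  from right_endsD[OF this] have m: "prv S (ds ! Suc h) \<le> Suc (ds ! Suc h)" by simp
  have new: "new j = d \<longleftrightarrow> j \<in> ival S d \<and>
      (d \<in> set (take (Suc h) ds) \<or> d = ds ! Suc h \<and> Suc (ds ! Suc h) \<le> j)"
    if "j \<in> {1..length S}" "d > 0" for j d
    using I(10)[OF that] I(1) by (auto simp: take_Suc_conv_app_nth ival_def)
  show ?thesis by (rule trialI) (fact I m h new order_refl)+
qed

text \<open>The new choice is the queue together with the unmarked intervals of \<open>C\<close>.
  Two queued intervals sharing \<open>j\<close> would give \<open>new j\<close> two values; a queued
  one meeting an unmarked one would have marked it as the owner; unmarked ones are disjoint already
  in \<open>C\<close>. Letters lost by dropping marked intervals are regained from the
  queue.\<close>

lemma trial_finish: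
  assumes trial: "trial ds h (prv S (ds ! h)) new fl" and h: "Suc h = length ds"
    and own': "\<And>k. k \<in> {1..length S} \<Longrightarrow>
      own' k = (if new k > 0 then new k else if fl (own k) > 0 then 0 else own k)"
  shows "\<exists>C'. valid S C' (insert (letter S e0) B) \<and> owns S C' own'"
proof -
  note I = trialD[OF trial]
  define C' where "C' = {r \<in> C. fl r = 0} \<union> set ds"
  have "set ds = set (take (Suc h) ds)" using h by simp
  also have "\<dots> = insert (ds ! h) (set (take h ds))" using I(1) by (simp add: take_Suc_conv_app_nth)
  finally have set_ds: "set ds = insert (ds ! h) (set (take h ds))" .
  have new: "new j = d \<longleftrightarrow> j \<in> ival S d \<and> d \<in> set ds" if "j \<in> {1..length S}" "d > 0" for j d
    using I(10)[OF that] set_ds by (auto simp: ival_def)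
  have pos: "0 < d" if "d \<in> set ds \<or> d \<in> C" for d
    using that I(6) C_simps(1) right_endsD(3) by blast
  have sub: "C' \<subseteq> right_ends S" using I(6) C_simps(1) by (auto simp: C'_def)
  have fresh: "letter S r \<noteq> letter S d" if rd: "r \<in> C" "fl r = 0" "d \<in> set ds" for r d
  proof
    assume l: "letter S r = letter S d"
    consider "d = e0" | r' where "r' \<in> C" "fl r' > 0" "letter S d = letter S r'"
      using I(8)[OF rd(3)] by blast
    then show False
    proof cases
      case 1
      then show False using l rd(1) e0_new C_simps(3) by (metis imageI)
    next
      case 2
      then have "r' = r" using l rd(1) C_simps(2) by (auto simp: inj_on_def)
      then show False using 2(2) rd(2) by simp
    qed
  qed
  have sep: "ival S r \<inter> ival S d = {}" if "r \<in> C" "fl r = 0" "d \<in> set ds" for r d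
  proof (rule ccontr)
    assume "ival S r \<inter> ival S d \<noteq> {}"
    then obtain j where j: "j \<in> ival S r" "j \<in> ival S d" by blast
    have jS: "j \<in> {1..length S}" using j(1) that(1) C_simps(1) ival_subset by blast
    have "new j = d" "own j = r"
      using new[OF jS] ownsD[OF owns_C jS] pos that j by auto
    then show False using I(11)[OF jS] pos that by auto
  qed
  have disj: "ival S d \<inter> ival S e = {}" if "d \<in> C'" "e \<in> C'" "d \<noteq> e" for d e
  proof -
    have "ival S d \<inter> ival S e = {}" if de: "d \<in> set ds" "e \<in> set ds"
    proof (rule ccontr)
      assume "ival S d \<inter> ival S e \<noteq> {}"
      then obtain j where j: "j \<in> ival S d" "j \<in> ival S e" by blast
      have jS: "j \<in> {1..length S}" using j(1) de(1) I(6) ival_subset by blast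
      have "new j = d" "new j = e" using new[OF jS] pos de j by auto
      then show False using \<open>d \<noteq> e\<close> by simp
    qed
    then show ?thesis using that C_simps(4)[of d e] sep[of d e] sep[of e d] unfolding C'_def by blast
  qed
  have inj: "inj_on (letter S) C'"
    unfolding C'_def inj_on_Un
  proof (intro conjI)
    show "inj_on (letter S) {r \<in> C. fl r = 0}" using C_simps(2) by (rule inj_on_subset) auto
    show "inj_on (letter S) (set ds)" by (fact I(7))
    show "letter S ` ({r \<in> C. fl r = 0} - set ds) \<inter> letter S ` (set ds - {r \<in> C. fl r = 0}) = {}"
      using fresh by (auto simp: disjoint_iff)
  qed
  have "letter S ` C' = insert (letter S e0) B"
  proof (intro equalityI subsetI)
    fix a assume "a \<in> letter S ` C'"
    then obtain d where d: "a = letter S d" "d \<in> C \<or> d \<in> set ds" by (auto simp: C'_def)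
    then show "a \<in> insert (letter S e0) B"
      using I(8)[of d] C_simps(3) by auto
  next
    fix a assume a: "a \<in> insert (letter S e0) B"
    show "a \<in> letter S ` C'"
    proof (cases "a = letter S e0")
      case True
      then show ?thesis using I(5) by (auto simp: C'_def)
    next
      case False
      then obtain r where r: "r \<in> C" "a = letter S r" using a C_simps(3) by auto
      then show ?thesis using I(9)[OF r(1)] by (cases "fl r = 0") (auto simp: C'_def)
    qed
  qed
  then have "valid S C' (insert (letter S e0) B)"
    using sub inj disj unfolding valid_def by blast
  moreover have "owns S C' own'"
    unfolding owns_def
  proof (intro ballI allI impI)
    fix k e :: nat assume k: "k \<in> {1..length S}" and e: "0 < e"
    show "own' k = e \<longleftrightarrow> e \<in> C' \<and> k \<in> ival S e"
    proof (cases "new k > 0")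
      case True
      then have *: "k \<in> ival S (new k)" "new k \<in> set ds" using new[OF k, of "new k"] by auto
      then have "new k \<in> C'" by (simp add: C'_def)
      then show ?thesis using True own'[OF k] * disj[of "new k" e] by auto
    next
      case False
      then have "\<not> (k \<in> ival S e \<and> e \<in> set ds)" using new[OF k e] e by auto
      then have "e \<in> C' \<and> k \<in> ival S e \<longleftrightarrow> fl e = 0 \<and> own k = e"
        using ownsD[OF owns_C k e] by (auto simp: C'_def)
      then show ?thesis using False own'[OF k] e by auto
    qed
  qed
  ultimately show ?thesis by blast
qed

end

section \<open>An imperative language and its compilation\<close>

datatype var = Ans | Alph | Len | Cnt | Pos | Cur | Todo | Ok | Go | End | Low | Tmp | Owner | Hd | Tl
datatype arr = Last | Prv | Nxt | Own | New | Flip | Queue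

datatype com =
    Skip
  | Zero var
  | Copy var var
  | Succ var var
  | Pred var var
  | Minus var var var
  | Get var arr var
  | Put arr var var
  | Input var
  | Seq com com (infixr \<open>;;\<close> 60)
  | IfPos var com com
  | WhilePos var com

text \<open>\<open>Ans\<close> is put in register 0, where the machine's answer is read.\<close>

fun reg_of :: "var \<Rightarrow> nat" where
  "reg_of Ans = 0" | "reg_of Alph = 1" | "reg_of Len = 2" | "reg_of Cnt = 3" | "reg_of Pos = 4"
| "reg_of Cur = 5" | "reg_of Todo = 6" | "reg_of Ok = 7" | "reg_of Go = 8" | "reg_of End = 9"
| "reg_of Low = 10" | "reg_of Tmp = 11" | "reg_of Owner = 12" | "reg_of Hd = 13" | "reg_of Tl = 14"

text \<open>The array lengths depend on the input, so the seven arrays are interleaved with stride 8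
  instead of being laid out one after another. The bases are distinct modulo 8, and starting at 24
  keeps all entries clear of the variables and the scratch registers.\<close>

fun base_of :: "arr \<Rightarrow> nat" where
  "base_of Last = 24" | "base_of Prv = 25" | "base_of Nxt = 26" | "base_of Own = 27"
| "base_of New = 28" | "base_of Flip = 29" | "base_of Queue = 30"

lemma reg_of_less: "reg_of v < 15" by (cases v) auto
lemma reg_of_inj: "reg_of v = reg_of w \<longleftrightarrow> v = w" by (cases v; cases w) auto
lemma base_of_bounds: "24 \<le> base_of f" "base_of f < 32" by (cases f; simp)+
lemma base_of_inj: "base_of f = base_of g \<longleftrightarrow> f = g" by (cases f; cases g) auto

lemma address_inj: "8 * k + base_of f = 8 * l + base_of g \<longleftrightarrow> k = l \<and> f = g"
proof
  assume *: "8 * k + base_of f = 8 * l + base_of g"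
  then have "k = l" using base_of_bounds[of f] base_of_bounds[of g] by linarith
  then show "k = l \<and> f = g" using * by (simp add: base_of_inj)
qed simp

type_synonym store = "(var \<Rightarrow> nat) \<times> (arr \<Rightarrow> nat \<Rightarrow> nat) \<times> nat list"

text \<open>The time is the exact number of steps of the compiled code. A positive test jumps at
  cost 1; the other branch of a conditional also pays 2 for jumping over the first. Each round of a
  loop pays the test and the jump back, and the exit pays the failed test and the jump out.\<close>

inductive big_step :: "com \<Rightarrow> store \<Rightarrow> nat \<Rightarrow> store \<Rightarrow> bool" where
  "big_step (Zero x) (V, A, inp) 1 (V(x := 0), A, inp)"
| "big_step (Copy x y) (V, A, inp) 2 (V(x := V y), A, inp)"
| "big_step (Succ x y) (V, A, inp) 2 (V(x := V y + 1), A, inp)"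
| "big_step (Pred x y) (V, A, inp) 2 (V(x := V y - 1), A, inp)"
| "big_step (Minus x y z) (V, A, inp) 1 (V(x := V y - V z), A, inp)"
| "big_step (Get x f y) (V, A, inp) 6 (V(x := A f (V y)), A, inp)"
| "big_step (Put f y x) (V, A, inp) 6 (V, A(f := (A f)(V y := V x)), inp)"
| "big_step (Input x) (V, A, inp) 1 (V(x := (case inp of [] \<Rightarrow> 0 | i # _ \<Rightarrow> i)), A, tl inp)"
| "big_step c s t s' \<Longrightarrow> big_step d s' t' s'' \<Longrightarrow> big_step (c ;; d) s (t + t') s''"
| "0 < V x \<Longrightarrow> big_step c (V, A, inp) t s' \<Longrightarrow> big_step (IfPos x c d) (V, A, inp) (t + 1) s'"
| "V x = 0 \<Longrightarrow> big_step d (V, A, inp) t s' \<Longrightarrow> big_step (IfPos x c d) (V, A, inp) (t + 3) s'"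
| "0 < V x \<Longrightarrow> big_step c (V, A, inp) t s' \<Longrightarrow> big_step (WhilePos x c) s' t' s'' \<Longrightarrow>
     big_step (WhilePos x c) (V, A, inp) (t + t' + 3) s''"
| "V x = 0 \<Longrightarrow> big_step (WhilePos x c) (V, A, inp) 3 (V, A, inp)"
| "big_step Skip s 0 s"

text \<open>Registers 16 and 17 are scratch; entry \<open>k\<close> of the array \<open>f\<close> is kept at address
  \<open>8 * k + base_of f\<close>.\<close>

definition locate :: "arr \<Rightarrow> var \<Rightarrow> instr list" where
  "locate f y = [Add 16 (reg_of y) (reg_of y), Add 16 16 16, Add 16 16 16,
     Const 17 (base_of f), Add 16 16 17]"

lemma length_locate [simp]: "length (locate f y) = 5"
  by (simp add: locate_def)

fun code_size :: "com \<Rightarrow> nat" where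
  "code_size Skip = 0"
| "code_size (Zero x) = 1"
| "code_size (Copy x y) = 2"
| "code_size (Succ x y) = 2"
| "code_size (Pred x y) = 2"
| "code_size (Minus x y z) = 1"
| "code_size (Get x f y) = 6"
| "code_size (Put f y x) = 6"
| "code_size (Input x) = 1"
| "code_size (c ;; d) = code_size c + code_size d"
| "code_size (IfPos x c d) = code_size c + code_size d + 3"
| "code_size (WhilePos x c) = code_size c + 5"

text \<open>Jump targets are absolute, so the start address \<open>a\<close> is passed along, and
  \<open>code_size\<close> yields targets lying behind code not yet emitted. The only test jumps on
  a positive value; hence the negative branch comes first, and an unconditional jump first sets
  register 16 to 1.\<close>

fun compile :: "com \<Rightarrow> nat \<Rightarrow> instr list" where
  "compile Skip a = []"
| "compile (Zero x) a = [Const (reg_of x) 0]"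
| "compile (Copy x y) a = [Const 16 0, Add (reg_of x) (reg_of y) 16]"
| "compile (Succ x y) a = [Const 16 1, Add (reg_of x) (reg_of y) 16]"
| "compile (Pred x y) a = [Const 16 1, Sub (reg_of x) (reg_of y) 16]"
| "compile (Minus x y z) a = [Sub (reg_of x) (reg_of y) (reg_of z)]"
| "compile (Get x f y) a = locate f y @ [Load (reg_of x) 16]"
| "compile (Put f y x) a = locate f y @ [Store 16 (reg_of x)]"
| "compile (Input x) a = [Read (reg_of x)]"
| "compile (c ;; d) a = compile c a @ compile d (a + code_size c)"
| "compile (IfPos x c d) a =
     [JumpPos (reg_of x) (a + code_size d + 3)] @ compile d (a + 1) @
     [Const 16 1, JumpPos 16 (a + code_size d + 3 + code_size c)] @
     compile c (a + code_size d + 3)"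
| "compile (WhilePos x c) a =
     [JumpPos (reg_of x) (a + 3)] @ [Const 16 1, JumpPos 16 (a + code_size c + 5)] @
     compile c (a + 3) @ [Const 16 1, JumpPos 16 a]"

lemma length_compile [simp]: "length (compile c a) = code_size c"
  by (induction c arbitrary: a) auto

text \<open>The bound covers every intermediate configuration, because \<open>word_bounded\<close>
  speaks of all times and not only of the final state.\<close>

definition runs :: "instr list \<Rightarrow> nat \<Rightarrow> config \<Rightarrow> nat \<Rightarrow> config \<Rightarrow> bool" where
  "runs p b c t c' \<longleftrightarrow> (step p ^^ t) c = c' \<and> (\<forall>u\<le>t. \<forall>i. reg ((step p ^^ u) c) i \<le> b)"

lemma runs_0: "(\<forall>i. reg c i \<le> b) \<Longrightarrow> runs p b c 0 c"
  by (simp add: runs_def)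

lemma runs_trans:
  assumes "runs p b c t c'" "runs p b c' t' c''"
  shows "runs p b c (t + t') c''"
  unfolding runs_def
proof (intro conjI allI impI)
  have eq: "(step p ^^ (t + u)) c = (step p ^^ u) c'" for u
    using assms(1) by (simp add: runs_def funpow_add add.commute[of t])
  show "(step p ^^ (t + t')) c = c''" using assms(2) by (simp add: eq) (simp add: runs_def)
  fix u i assume "u \<le> t + t'"
  show "reg ((step p ^^ u) c) i \<le> b"
  proof (cases "u \<le> t")
    case False
    then have "u = t + (u - t)" "u - t \<le> t'" using \<open>u \<le> t + t'\<close> by auto
    then show ?thesis using assms(2) eq[of "u - t"] by (simp add: runs_def)
  qed (use assms(1) in \<open>simp add: runs_def\<close>)
qed

definition code_at :: "instr list \<Rightarrow> nat \<Rightarrow> instr list \<Rightarrow> bool" where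
  "code_at p a ps \<longleftrightarrow> (\<exists>us vs. p = us @ ps @ vs \<and> length us = a)"

lemma code_at_append:
  "code_at p a (ps @ qs) \<longleftrightarrow> code_at p a ps \<and> code_at p (a + length ps) qs"
proof
  assume "code_at p a (ps @ qs)"
  then obtain us vs where "p = us @ ps @ qs @ vs" "length us = a" by (auto simp: code_at_def)
  then show "code_at p a ps \<and> code_at p (a + length ps) qs"
    unfolding code_at_def by (metis append.assoc length_append)
next
  assume "code_at p a ps \<and> code_at p (a + length ps) qs"
  then obtain us vs us' vs' where *: "p = us @ ps @ vs" "length us = a"
    "p = us' @ qs @ vs'" "length us' = a + length ps" unfolding code_at_def by blast
  then have "(us @ ps) @ vs = us' @ qs @ vs'" by simp
  then have "vs = qs @ vs'" using * by (subst (asm) append_eq_append_conv) auto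
  then show "code_at p a (ps @ qs)" using * by (auto simp: code_at_def)
qed

lemma code_at_Cons_Cons:
  "code_at p a (i # j # ps) \<longleftrightarrow> code_at p a [i] \<and> code_at p (Suc a) (j # ps)"
  using code_at_append[of p a "[i]" "j # ps"] by simp

lemma runs_step:
  assumes "code_at p a [i]" "exec i (a, X, inp) = (a', X', inp')" "\<forall>j. X j \<le> b" "\<forall>j. X' j \<le> b"
    and "runs p b (a', X', inp') t c"
  shows "runs p b (a, X, inp) (Suc t) c"
proof -
  have "step p (a, X, inp) = (a', X', inp')"
    using assms(1,2) by (auto simp: code_at_def step_def halted_def)
  then have "runs p b (a, X, inp) 1 (a', X', inp')"
    using assms(3,4) by (auto simp: runs_def reg_def le_Suc_eq)
  from runs_trans[OF this assms(5)] show ?thesis by simp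
qed

section \<open>Compiler correctness\<close>

definition represents :: "(nat \<Rightarrow> nat) \<Rightarrow> (var \<Rightarrow> nat) \<Rightarrow> (arr \<Rightarrow> nat \<Rightarrow> nat) \<Rightarrow> bool" where
  "represents X V A \<longleftrightarrow> (\<forall>v. X (reg_of v) = V v) \<and> (\<forall>f k. X (8 * k + base_of f) = A f k)"

definition bounded_store :: "nat \<Rightarrow> store \<Rightarrow> bool" where
  "bounded_store m = (\<lambda>(V, A, inp). (\<forall>v. V v \<le> m) \<and> (\<forall>f k. A f k \<le> m) \<and> (\<forall>i\<in>set inp. i \<le> m))"

lemma bounded_store_mono: "bounded_store m s \<Longrightarrow> m \<le> m' \<Longrightarrow> bounded_store m' s"
  unfolding bounded_store_def by (auto intro: order_trans)

lemma big_step_bounded: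
  "big_step c s t s' \<Longrightarrow> bounded_store m s \<Longrightarrow> bounded_store (m + t) s'"
proof (induction arbitrary: m rule: big_step.induct)
  case (8 x V A inp)
  then show ?case by (cases inp) (auto simp: bounded_store_def trans_le_add1 le_SucI)
next
  case (9 c s t s' d t' s'')
  then show ?case by (metis add.assoc)
next
  case (10 V x c A inp t s' d)
  then show ?case by (fastforce intro: bounded_store_mono)
next
  case (11 V x d A inp t s' c)
  then show ?case by (fastforce intro: bounded_store_mono)
next
  case (12 V x c A inp t s' t' s'')
  then have "bounded_store (m + t + t') s''" by blast
  then show ?case by (rule bounded_store_mono) simp
qed (auto simp: bounded_store_def trans_le_add1 le_SucI intro!: le_diff_conv[THEN iffD2])

lemma represents_scratch: "represents X V A \<Longrightarrow> j \<in> {16, 17} \<Longrightarrow> represents (X(j := c)) V A"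
proof -
  have "reg_of v \<noteq> 16" "reg_of v \<noteq> 17" "8 * k + base_of f \<noteq> 16" "8 * k + base_of f \<noteq> 17" for v f k
    using base_of_bounds[of f] reg_of_less[of v] by auto
  then show "represents X V A \<Longrightarrow> j \<in> {16, 17} \<Longrightarrow> represents (X(j := c)) V A"
    by (auto simp: represents_def)
qed

lemma represents_var: "represents X V A \<Longrightarrow> represents (X(reg_of x := c)) (V(x := c)) A"
proof -
  have "8 * k + base_of f \<noteq> reg_of x" for f k
    using base_of_bounds[of f] reg_of_less[of x] by auto
  then show "represents X V A \<Longrightarrow> represents (X(reg_of x := c)) (V(x := c)) A"
    by (auto simp: represents_def reg_of_inj)
qed

lemma represents_arr:
  "represents X V A \<Longrightarrow> represents (X(8 * k + base_of f := c)) V (A(f := (A f)(k := c)))"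
proof -
  have "reg_of x \<noteq> 8 * k + base_of f" for x
    using base_of_bounds[of f] reg_of_less[of x] by auto
  then show "represents X V A \<Longrightarrow> ?thesis"
    by (auto simp: represents_def address_inj)
qed

lemma represents_reg: "represents X V A \<Longrightarrow> X (reg_of v) = V v"
  by (simp add: represents_def)

lemma represents_address: "represents X V A \<Longrightarrow> X (8 * k + base_of f) = A f k"
  by (simp add: represents_def)

lemma runs_single:
  assumes "code_at p a [i]" "exec i (a, X, inp) = (a', X', inp')" "\<forall>j. X j \<le> b" "\<forall>j. X' j \<le> b"
  shows "runs p b (a, X, inp) 1 (a', X', inp')"
  using runs_step[OF assms runs_0] assms(4) by (simp add: reg_def)

lemma locate_correct:
  assumes "code_at p a (locate f y)" "represents X V A" "8 * V y + 32 \<le> b" "\<forall>j. X j \<le> b"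
  shows "\<exists>X'. runs p b (a, X, inp) 5 (a + 5, X', inp) \<and> represents X' V A \<and> (\<forall>j. X' j \<le> b) \<and>
           X' 16 = 8 * V y + base_of f"
proof -
  let ?X1 = "X(16 := 2 * V y)"
  let ?X2 = "?X1(16 := 4 * V y)"
  let ?X3 = "?X2(16 := 8 * V y)"
  let ?X4 = "?X3(17 := base_of f)"
  let ?X5 = "?X4(16 := 8 * V y + base_of f)"
  note code = assms(1)[unfolded locate_def code_at_Cons_Cons]
  have b: "base_of f \<le> b" "8 * V y + base_of f \<le> b" using assms(3) base_of_bounds[of f] by auto
  have Xy: "X (reg_of y) = V y" using assms(2) by (rule represents_reg)
  have 1: "runs p b (a, X, inp) 1 (a + 1, ?X1, inp)"
    by (rule runs_single[of _ _ "Add 16 (reg_of y) (reg_of y)"]) (use code Xy assms(3,4) in auto)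
  have 2: "runs p b (a + 1, ?X1, inp) 1 (a + 2, ?X2, inp)"
    by (rule runs_single[of _ _ "Add 16 16 16"]) (use code assms(3,4) in auto)
  have 3: "runs p b (a + 2, ?X2, inp) 1 (a + 3, ?X3, inp)"
    by (rule runs_single[of _ _ "Add 16 16 16"]) (use code assms(3,4) in \<open>auto simp: eval_nat_numeral\<close>)
  have 4: "runs p b (a + 3, ?X3, inp) 1 (a + 4, ?X4, inp)"
    by (rule runs_single[of _ _ "Const 17 (base_of f)"]) (use code b assms(3,4) in \<open>auto simp: eval_nat_numeral\<close>)
  have 5: "runs p b (a + 4, ?X4, inp) 1 (a + 5, ?X5, inp)"
    by (rule runs_single[of _ _ "Add 16 16 17"]) (use code b assms(3,4) in \<open>auto simp: eval_nat_numeral\<close>)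
  have "runs p b (a, X, inp) 5 (a + 5, ?X5, inp)"
    using runs_trans[OF 1 runs_trans[OF 2 runs_trans[OF 3 runs_trans[OF 4 5]]]] by (simp add: numeral_eq_Suc)
  moreover have "represents ?X5 V A"
    using assms(2) by (intro represents_scratch) auto
  moreover have "\<forall>j. ?X5 j \<le> b" using b assms(4) by auto
  moreover have "?X5 16 = 8 * V y + base_of f" by simp
  ultimately show ?thesis by blast
qed

lemma scratch_then:
  assumes code: "code_at p a [Const 16 c, i]"
    and "represents X V A" "\<forall>j. X j \<le> b" "c \<le> b"
    and i: "exec i (Suc a, X(16 := c), inp) = (a', (X(16 := c))(reg_of x := d), inp)" "d \<le> b"
  shows "\<exists>X'. runs p b (a, X, inp) 2 (a', X', inp) \<and> represents X' (V(x := d)) A \<and> (\<forall>j. X' j \<le> b)"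
proof -
  have "runs p b (a, X, inp) 1 (Suc a, X(16 := c), inp)"
    using code assms(3,4) by (intro runs_single[of _ _ "Const 16 c"]) (auto simp: code_at_Cons_Cons)
  moreover have "runs p b (Suc a, X(16 := c), inp) 1 (a', (X(16 := c))(reg_of x := d), inp)"
    using code assms(3,4) i by (intro runs_single[of _ _ i]) (auto simp: code_at_Cons_Cons)
  ultimately have "runs p b (a, X, inp) 2 (a', (X(16 := c))(reg_of x := d), inp)"
    using runs_trans[of p b "(a, X, inp)" 1 "(Suc a, X(16 := c), inp)" 1] by (simp add: numeral_2_eq_2)
  moreover have "represents ((X(16 := c))(reg_of x := d)) (V(x := d)) A"
    using assms(2) by (intro represents_var represents_scratch) auto
  ultimately show ?thesis using assms(3,4) i(2) by (metis fun_upd_apply)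
qed

lemma goto_runs:
  assumes "code_at p a [Const 16 1, JumpPos 16 l]" "represents X V A" "\<forall>j. X j \<le> b" "1 \<le> b"
  shows "\<exists>X'. runs p b (a, X, inp) 2 (l, X', inp) \<and> represents X' V A \<and> (\<forall>j. X' j \<le> b)"
proof -
  have 1: "runs p b (a, X, inp) 1 (Suc a, X(16 := 1), inp)"
    using assms by (intro runs_single[of _ _ "Const 16 1"]) (auto simp: code_at_Cons_Cons)
  have "runs p b (Suc a, X(16 := 1), inp) 1 (l, X(16 := 1), inp)"
    using assms by (intro runs_single[of _ _ "JumpPos 16 l"]) (auto simp: code_at_Cons_Cons)
  from runs_trans[OF 1 this] have "runs p b (a, X, inp) 2 (l, X(16 := 1), inp)" by (simp add: numeral_2_eq_2)
  then show ?thesis using assms by (metis fun_upd_apply represents_scratch insertI1)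
qed

text \<open>Here \<open>n\<close> bounds the stored values during the whole run, and
  \<open>b\<close> also has room for addresses \<open>8 * k + base_of f\<close> with
  \<open>k \<le> n\<close>. The current bound \<open>m\<close> varies in the induction: after a
  first part taking time \<open>t\<close> it becomes \<open>m + t\<close> by
  \<open>big_step_bounded\<close>, while \<open>n\<close> and \<open>b\<close> stay fixed.\<close>

lemma compile_correct:
  assumes "big_step c s t s'" "code_at p a (compile c a)" "s = (V, A, inp)" "represents X V A"
    and "bounded_store m s" "m + t \<le> n" "b = 8 * n + 64" "\<forall>j. X j \<le> b"
  shows "\<exists>X'. runs p b (a, X, inp) t (a + code_size c, X', snd (snd s')) \<and>
           represents X' (fst s') (fst (snd s')) \<and> (\<forall>j. X' j \<le> b)"
  using assms
proof (induction arbitrary: a V A inp X m rule: big_step.induct)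
  case (1 x V A inp)
  then have "runs p b (a, X, inp) 1 (a + 1, X(reg_of x := 0), inp)"
    by (intro runs_single[of _ _ "Const (reg_of x) 0"]) auto
  moreover have "represents (X(reg_of x := 0)) (V(x := 0)) A" using 1 by (simp add: represents_var)
  moreover have "\<forall>j. (X(reg_of x := 0)) j \<le> b" using 1 by simp
  ultimately show ?case using "1.prems"(2) unfolding fst_conv snd_conv code_size.simps by blast
next
  case (2 x y V A inp)
  then have "V y \<le> b" by (auto simp: bounded_store_def intro: order_trans)
  then have "\<exists>X'. runs p b (a, X, inp) 2 (a + 2, X', inp) \<and> represents X' (V(x := V y)) A \<and> (\<forall>j. X' j \<le> b)"
    using 2 scratch_then[of p a 0 "Add (reg_of x) (reg_of y) 16" X V A b inp "a + 2" x "V y"]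
      represents_reg[of X V A y] reg_of_less[of y] by auto
  then show ?case using "2.prems"(2) unfolding fst_conv snd_conv code_size.simps by blast
next
  case (3 x y V A inp)
  then have "V y \<le> m" by (auto simp: bounded_store_def)
  then have "V y + 1 \<le> b" using 3 by simp
  then have "\<exists>X'. runs p b (a, X, inp) 2 (a + 2, X', inp) \<and> represents X' (V(x := V y + 1)) A \<and> (\<forall>j. X' j \<le> b)"
    using 3 scratch_then[of p a 1 "Add (reg_of x) (reg_of y) 16" X V A b inp "a + 2" x "V y + 1"]
      represents_reg[of X V A y] reg_of_less[of y] by auto
  then show ?case using "3.prems"(2) unfolding fst_conv snd_conv code_size.simps by blast
next
  case (4 x y V A inp)
  then have "V y \<le> m" by (auto simp: bounded_store_def)
  then have "V y - 1 \<le> b" using 4 by simp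
  then have "\<exists>X'. runs p b (a, X, inp) 2 (a + 2, X', inp) \<and> represents X' (V(x := V y - 1)) A \<and> (\<forall>j. X' j \<le> b)"
    using 4 scratch_then[of p a 1 "Sub (reg_of x) (reg_of y) 16" X V A b inp "a + 2" x "V y - 1"]
      represents_reg[of X V A y] reg_of_less[of y] by auto
  then show ?case using "4.prems"(2) unfolding fst_conv snd_conv code_size.simps by blast
next
  case (5 x y z V A inp)
  then have "V y \<le> m" by (auto simp: bounded_store_def)
  then have "V y - V z \<le> b" using 5 by simp
  moreover have "X (reg_of y) = V y" "X (reg_of z) = V z" using 5 by (auto intro: represents_reg)
  ultimately have "runs p b (a, X, inp) 1 (a + 1, X(reg_of x := V y - V z), inp)"
    using 5 by (intro runs_single[of _ _ "Sub (reg_of x) (reg_of y) (reg_of z)"]) auto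
  moreover have "represents (X(reg_of x := V y - V z)) (V(x := V y - V z)) A"
    using 5 by (simp add: represents_var)
  moreover have "\<forall>j. (X(reg_of x := V y - V z)) j \<le> b" using 5 \<open>V y - V z \<le> b\<close> by simp
  ultimately show ?case using "5.prems"(2) unfolding fst_conv snd_conv code_size.simps by blast
next
  case (6 x f y V A inp)
  then have bd: "V y \<le> m" "A f (V y) \<le> m" by (auto simp: bounded_store_def)
  have code: "code_at p a (locate f y)" "code_at p (a + 5) [Load (reg_of x) 16]"
    using 6 by (auto simp: code_at_append)
  obtain X' where X': "runs p b (a, X, inp) 5 (a + 5, X', inp)" "represents X' V A"
    "\<forall>j. X' j \<le> b" "X' 16 = 8 * V y + base_of f"
    using locate_correct[OF code(1), of X V A b inp] 6 bd by auto
  have "X' (X' 16) = A f (V y)" using X'(2,4) represents_address by simp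
  then have "runs p b (a + 5, X', inp) 1 (a + 6, X'(reg_of x := A f (V y)), inp)"
    using X' code 6 bd by (intro runs_single[of _ _ "Load (reg_of x) 16"]) auto
  from runs_trans[OF X'(1) this]
  have "runs p b (a, X, inp) 6 (a + 6, X'(reg_of x := A f (V y)), inp)" by (simp add: numeral_eq_Suc)
  moreover have "represents (X'(reg_of x := A f (V y))) (V(x := A f (V y))) A"
    using X'(2) by (simp add: represents_var)
  moreover have "\<forall>j. (X'(reg_of x := A f (V y))) j \<le> b" using X'(3) 6 bd by simp
  ultimately show ?case using "6.prems"(2) unfolding fst_conv snd_conv code_size.simps by blast
next
  case (7 f y x V A inp)
  then have bd: "V y \<le> m" "V x \<le> m" by (auto simp: bounded_store_def)
  have code: "code_at p a (locate f y)" "code_at p (a + 5) [Store 16 (reg_of x)]"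
    using 7 by (auto simp: code_at_append)
  obtain X' where X': "runs p b (a, X, inp) 5 (a + 5, X', inp)" "represents X' V A"
    "\<forall>j. X' j \<le> b" "X' 16 = 8 * V y + base_of f"
    using locate_correct[OF code(1), of X V A b inp] 7 bd by auto
  have "X' (reg_of x) = V x" using X'(2) represents_reg by simp
  then have "runs p b (a + 5, X', inp) 1 (a + 6, X'(8 * V y + base_of f := V x), inp)"
    using X' code 7 bd by (intro runs_single[of _ _ "Store 16 (reg_of x)"]) auto
  from runs_trans[OF X'(1) this]
  have "runs p b (a, X, inp) 6 (a + 6, X'(8 * V y + base_of f := V x), inp)" by (simp add: numeral_eq_Suc)
  moreover have "represents (X'(8 * V y + base_of f := V x)) V (A(f := (A f)(V y := V x)))"
    using X'(2) by (simp add: represents_arr)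
  moreover have "\<forall>j. (X'(8 * V y + base_of f := V x)) j \<le> b" using X'(3) 7 bd by simp
  ultimately show ?case using "7.prems"(2) unfolding fst_conv snd_conv code_size.simps by blast
next
  case (8 x V A inp)
  define i where "i = (case inp of [] \<Rightarrow> 0 | i # _ \<Rightarrow> i)"
  have "i \<le> m" using 8 by (auto simp: i_def bounded_store_def split: list.splits)
  then have "i \<le> b" using 8 by simp
  with 8 have "runs p b (a, X, inp) 1 (a + 1, X(reg_of x := i), tl inp)"
    by (intro runs_single[of _ _ "Read (reg_of x)"]) (auto simp: i_def)
  moreover have "represents (X(reg_of x := i)) (V(x := i)) A" using 8 by (simp add: represents_var)
  moreover have "\<forall>j. (X(reg_of x := i)) j \<le> b" using 8 \<open>i \<le> b\<close> by simp
  ultimately show ?case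
    using "8.prems"(2) unfolding fst_conv snd_conv code_size.simps i_def by blast
next
  case (9 c s t s' d t' s'')
  let ?V = "fst s'" and ?A = "fst (snd s')" and ?inp = "snd (snd s')"
  have s': "s' = (?V, ?A, ?inp)" by simp
  have code: "code_at p a (compile c a)" "code_at p (a + code_size c) (compile d (a + code_size c))"
    using "9.prems"(1) by (simp_all add: code_at_append)
  have le: "m + t \<le> n" "m + t + t' \<le> n" using "9.prems"(5) by simp_all
  obtain X1 where X1: "runs p b (a, X, inp) t (a + code_size c, X1, ?inp)" "represents X1 ?V ?A" "\<forall>j. X1 j \<le> b"
    using "9.IH"(1)[OF code(1) "9.prems"(2,3,4) le(1) "9.prems"(6,7)] by blast
  have bd: "bounded_store (m + t) s'" by (rule big_step_bounded[OF "9.hyps"(1) "9.prems"(4)])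
  obtain X2 where X2: "runs p b (a + code_size c, X1, ?inp) t' (a + code_size c + code_size d, X2, snd (snd s''))"
    "represents X2 (fst s'') (fst (snd s''))" "\<forall>j. X2 j \<le> b"
    using "9.IH"(2)[OF code(2) s' X1(2) bd le(2) "9.prems"(6) X1(3)] by blast
  have "runs p b (a, X, inp) (t + t') (a + code_size (c ;; d), X2, snd (snd s''))"
    using runs_trans[OF X1(1) X2(1)] by (simp add: add.assoc)
  then show ?case using X2(2,3) by blast
next
  case (10 V' x c A' inp' t s' d)
  have code: "code_at p a [JumpPos (reg_of x) (a + code_size d + 3)]"
    "code_at p (a + code_size d + 3) (compile c (a + code_size d + 3))"
    using "10.prems"(1)
    by (simp_all only: compile.simps code_at_append length_compile, simp_all add: ac_simps numeral_eq_Suc)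
  have le: "m + t \<le> n" using "10.prems"(5) by simp
  have "X (reg_of x) > 0" using "10.hyps"(1) "10.prems"(2) represents_reg[OF "10.prems"(3), of x] by simp
  then have *: "runs p b (a, X, inp) 1 (a + code_size d + 3, X, inp)"
    using "10.prems"(7) code by (intro runs_single[of _ _ "JumpPos (reg_of x) (a + code_size d + 3)"]) auto
  obtain X1 where "runs p b (a + code_size d + 3, X, inp) t (a + code_size d + 3 + code_size c, X1, snd (snd s'))"
    "represents X1 (fst s') (fst (snd s'))" "\<forall>j. X1 j \<le> b"
    using "10.IH"[OF code(2) "10.prems"(2,3,4) le "10.prems"(6,7)] by blast
  moreover from runs_trans[OF * this(1)]
  have "runs p b (a, X, inp) (t + 1) (a + code_size (IfPos x c d), X1, snd (snd s'))"
    by (simp add: algebra_simps)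
  ultimately show ?case by blast
next
  case (11 V' x d A' inp' t s' c)
  have code: "code_at p a [JumpPos (reg_of x) (a + code_size d + 3)]"
    "code_at p (a + 1) (compile d (a + 1))"
    "code_at p (a + 1 + code_size d) [Const 16 1, JumpPos 16 (a + code_size d + 3 + code_size c)]"
    using "11.prems"(1)
    by (simp_all only: compile.simps code_at_append length_compile, simp_all add: ac_simps numeral_eq_Suc)
  have le: "m + t \<le> n" using "11.prems"(5) by simp
  have "X (reg_of x) = 0" using "11.hyps"(1) "11.prems"(2) represents_reg[OF "11.prems"(3), of x] by simp
  then have *: "runs p b (a, X, inp) 1 (a + 1, X, inp)"
    using "11.prems"(7) code by (intro runs_single[of _ _ "JumpPos (reg_of x) (a + code_size d + 3)"]) auto
  obtain X1 where X1: "runs p b (a + 1, X, inp) t (a + 1 + code_size d, X1, snd (snd s'))"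
    "represents X1 (fst s') (fst (snd s'))" "\<forall>j. X1 j \<le> b"
    using "11.IH"[OF code(2) "11.prems"(2,3,4) le "11.prems"(6,7)] by blast
  obtain X2 where X2: "runs p b (a + 1 + code_size d, X1, snd (snd s')) 2
      (a + code_size d + 3 + code_size c, X2, snd (snd s'))"
    "represents X2 (fst s') (fst (snd s'))" "\<forall>j. X2 j \<le> b"
    using goto_runs[OF code(3) X1(2,3)] "11.prems"(6) by auto
  from runs_trans[OF * runs_trans[OF X1(1) X2(1)]]
  have "runs p b (a, X, inp) (t + 3) (a + code_size (IfPos x c d), X2, snd (snd s'))"
    by (simp add: algebra_simps eval_nat_numeral)
  then show ?case using X2(2,3) by blast
next
  case (12 V' x c A' inp' t s' t' s'')
  let ?V = "fst s'" and ?A = "fst (snd s')" and ?inp = "snd (snd s')"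
  have s': "s' = (?V, ?A, ?inp)" by simp
  have code: "code_at p a [JumpPos (reg_of x) (a + 3)]" "code_at p (a + 3) (compile c (a + 3))"
    "code_at p (a + 3 + code_size c) [Const 16 1, JumpPos 16 a]"
    using "12.prems"(1)
    by (simp_all only: compile.simps code_at_append length_compile, simp_all add: ac_simps numeral_eq_Suc)
  have le: "m + t \<le> n" "m + t + t' \<le> n" using "12.prems"(5) by simp_all
  have "X (reg_of x) > 0" using "12.hyps"(1) "12.prems"(2) represents_reg[OF "12.prems"(3), of x] by simp
  then have *: "runs p b (a, X, inp) 1 (a + 3, X, inp)"
    using "12.prems"(7) code by (intro runs_single[of _ _ "JumpPos (reg_of x) (a + 3)"]) auto
  obtain X1 where X1: "runs p b (a + 3, X, inp) t (a + 3 + code_size c, X1, ?inp)"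
    "represents X1 ?V ?A" "\<forall>j. X1 j \<le> b"
    using "12.IH"(1)[OF code(2) "12.prems"(2,3,4) le(1) "12.prems"(6,7)] by blast
  obtain X2 where X2: "runs p b (a + 3 + code_size c, X1, ?inp) 2 (a, X2, ?inp)"
    "represents X2 ?V ?A" "\<forall>j. X2 j \<le> b"
    using goto_runs[OF code(3) X1(2,3)] "12.prems"(6) by auto
  have bd: "bounded_store (m + t) s'" by (rule big_step_bounded[OF "12.hyps"(2) "12.prems"(4)])
  obtain X3 where X3: "runs p b (a, X2, ?inp) t' (a + code_size (WhilePos x c), X3, snd (snd s''))"
    "represents X3 (fst s'') (fst (snd s''))" "\<forall>j. X3 j \<le> b"
    using "12.IH"(2)[OF "12.prems"(1) s' X2(2) bd le(2) "12.prems"(6) X2(3)] by blast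
  have "1 + (t + (2 + t')) = t + t' + 3" by simp
  with runs_trans[OF * runs_trans[OF X1(1) runs_trans[OF X2(1) X3(1)]]] X3(2,3) show ?case by metis
next
  case (13 V' x c A' inp')
  have code: "code_at p a [JumpPos (reg_of x) (a + 3)]"
    "code_at p (a + 1) [Const 16 1, JumpPos 16 (a + code_size c + 5)]"
    using "13.prems"(1)
    by (simp_all only: compile.simps code_at_append length_compile, simp_all add: ac_simps numeral_eq_Suc)
  have "X (reg_of x) = 0" using "13.hyps"(1) "13.prems"(2) represents_reg[OF "13.prems"(3), of x] by simp
  then have *: "runs p b (a, X, inp) 1 (a + 1, X, inp)"
    using "13.prems"(7) code by (intro runs_single[of _ _ "JumpPos (reg_of x) (a + 3)"]) auto
  obtain X2 where X2: "runs p b (a + 1, X, inp) 2 (a + code_size c + 5, X2, inp)"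
    "represents X2 V A" "\<forall>j. X2 j \<le> b"
    using goto_runs[OF code(2) "13.prems"(3,7)] "13.prems"(6) by auto
  from runs_trans[OF * X2(1)]
  have "runs p b (a, X, inp) 3 (a + code_size (WhilePos x c), X2, inp)"
    by (simp add: algebra_simps eval_nat_numeral)
  then show ?case using X2(2,3) "13.prems"(2) by auto
next
  case (14 s)
  then show ?case using runs_0[of "(a, X, inp)" b p] by (auto simp: reg_def)
qed

section \<open>Weakest preconditions with time\<close>

text \<open>The last argument of a postcondition is the time at which it is evaluated.\<close>

definition wp :: "com \<Rightarrow> ((var \<Rightarrow> nat) \<Rightarrow> (arr \<Rightarrow> nat \<Rightarrow> nat) \<Rightarrow> nat list \<Rightarrow> nat \<Rightarrow> bool) \<Rightarrow>
    (var \<Rightarrow> nat) \<Rightarrow> (arr \<Rightarrow> nat \<Rightarrow> nat) \<Rightarrow> nat list \<Rightarrow> nat \<Rightarrow> bool" where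
  "wp c Q V A inp t \<longleftrightarrow>
     (\<exists>u V' A' inp'. big_step c (V, A, inp) u (V', A', inp') \<and> Q V' A' inp' (t + u))"

inductive_cases big_step_elims:
  "big_step Skip s t s'" "big_step (Zero x) s t s'" "big_step (Copy x y) s t s'"
  "big_step (Succ x y) s t s'" "big_step (Pred x y) s t s'" "big_step (Minus x y z) s t s'"
  "big_step (Get x f y) s t s'" "big_step (Put f y x) s t s'" "big_step (Input x) s t s'"
inductive_cases Seq_elim: "big_step (c ;; d) s t s'"
inductive_cases IfPos_elim: "big_step (IfPos x c d) s t s'"

lemma wpI:
  "big_step c (V, A, inp) u (V', A', inp') \<Longrightarrow> Q V' A' inp' t' \<Longrightarrow> t' = t + u \<Longrightarrow> wp c Q V A inp t"
  unfolding wp_def by blast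

lemma wp_deterministic:
  assumes "\<And>u s'. big_step c (V, A, inp) u s' \<longleftrightarrow> u = u\<^sub>0 \<and> s' = (V\<^sub>0, A\<^sub>0, inp\<^sub>0)"
  shows "wp c Q V A inp t \<longleftrightarrow> Q V\<^sub>0 A\<^sub>0 inp\<^sub>0 (t + u\<^sub>0)"
  unfolding wp_def assms by simp

text \<open>As equivalences these let rewriting execute straight-line code symbolically, the elapsed
  time accumulating in the last argument.\<close>

lemma wp_basic:
  "wp Skip Q V A inp t \<longleftrightarrow> Q V A inp t"
  "wp (Zero x) Q V A inp t \<longleftrightarrow> Q (V(x := 0)) A inp (t + 1)"
  "wp (Copy x y) Q V A inp t \<longleftrightarrow> Q (V(x := V y)) A inp (t + 2)"
  "wp (Succ x y) Q V A inp t \<longleftrightarrow> Q (V(x := V y + 1)) A inp (t + 2)"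
  "wp (Pred x y) Q V A inp t \<longleftrightarrow> Q (V(x := V y - 1)) A inp (t + 2)"
  "wp (Minus x y z) Q V A inp t \<longleftrightarrow> Q (V(x := V y - V z)) A inp (t + 1)"
  "wp (Get x f y) Q V A inp t \<longleftrightarrow> Q (V(x := A f (V y))) A inp (t + 6)"
  "wp (Put f y x) Q V A inp t \<longleftrightarrow> Q V (A(f := (A f)(V y := V x))) inp (t + 6)"
  "wp (Input x) Q V A inp t \<longleftrightarrow> Q (V(x := (case inp of [] \<Rightarrow> 0 | i # _ \<Rightarrow> i))) A (tl inp) (t + 1)"
  \<comment> \<open>The simplified instance with \<open>u\<^sub>0 = 0\<close> is for
    \<open>Skip\<close>, where the time stays \<open>t\<close>.\<close>
  by (rule wp_deterministic[where u\<^sub>0 = 0, simplified] wp_deterministic, rule iffI, erule big_step_elims,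
      simp, elim conjE, hypsubst, rule big_step.intros)+

lemma wp_Seq: "wp (c ;; d) Q = wp c (wp d Q)"
proof (intro ext iffI)
  fix V A inp t
  assume "wp (c ;; d) Q V A inp t"
  then obtain u V' A' inp' where "big_step (c ;; d) (V, A, inp) u (V', A', inp')" and Q: "Q V' A' inp' (t + u)"
    unfolding wp_def by blast
  then obtain u1 s u2 where 1: "big_step c (V, A, inp) u1 s" and 2: "big_step d s u2 (V', A', inp')"
    and u: "u = u1 + u2"
    by (elim Seq_elim)
  obtain V1 A1 inp1 where s: "s = (V1, A1, inp1)" by (cases s)
  have "wp d Q V1 A1 inp1 (t + u1)"
    unfolding wp_def using 2 Q unfolding s u add.assoc by blast
  then show "wp c (wp d Q) V A inp t" unfolding wp_def[of c] using 1 unfolding s by blast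
next
  fix V A inp t
  assume "wp c (wp d Q) V A inp t"
  then obtain u V' A' inp' where 1: "big_step c (V, A, inp) u (V', A', inp')" and "wp d Q V' A' inp' (t + u)"
    unfolding wp_def[of c] by blast
  then obtain u' V'' A'' inp'' where 2: "big_step d (V', A', inp') u' (V'', A'', inp'')"
    and Q: "Q V'' A'' inp'' (t + u + u')" unfolding wp_def by blast
  show "wp (c ;; d) Q V A inp t"
    unfolding wp_def using big_step.intros(9)[OF 1 2] Q unfolding add.assoc by blast
qed

lemma wp_IfPos:
  "wp (IfPos x c d) Q V A inp t \<longleftrightarrow> (if 0 < V x then wp c Q V A inp (t + 1) else wp d Q V A inp (t + 3))"
proof
  assume "wp (IfPos x c d) Q V A inp t"
  then obtain u V' A' inp' where "big_step (IfPos x c d) (V, A, inp) u (V', A', inp')" and "Q V' A' inp' (t + u)"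
    unfolding wp_def by blast
  then show "if 0 < V x then wp c Q V A inp (t + 1) else wp d Q V A inp (t + 3)"
    by (auto elim!: IfPos_elim intro: wpI)
next
  assume *: "if 0 < V x then wp c Q V A inp (t + 1) else wp d Q V A inp (t + 3)"
  show "wp (IfPos x c d) Q V A inp t"
  proof (cases "0 < V x")
    case True
    then obtain u V' A' inp' where "big_step c (V, A, inp) u (V', A', inp')" "Q V' A' inp' (t + 1 + u)"
      using * unfolding wp_def by auto
    then show ?thesis by (intro wpI[OF big_step.intros(10)[of V x, OF True]]) auto
  next
    case False
    then obtain u V' A' inp' where "big_step d (V, A, inp) u (V', A', inp')" "Q V' A' inp' (t + 3 + u)"
      using * unfolding wp_def by auto
    moreover have "V x = 0" using False by simp
    ultimately show ?thesis by (intro wpI[OF big_step.intros(11)[of V x]]) (auto simp: ac_simps)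
  qed
qed

lemmas wp_simps = wp_basic wp_Seq wp_IfPos

lemma wp_mono:
  "wp c Q V A inp t \<Longrightarrow> (\<And>V A inp t. Q V A inp t \<Longrightarrow> Q' V A inp t) \<Longrightarrow> wp c Q' V A inp t"
  unfolding wp_def by blast

text \<open>The invariant carries its own measure \<open>n\<close>, so termination is included. The
  measure may drop by any amount, which allows a loop to be left early, and the time budget is
  stated as part of \<open>I\<close>.\<close>

lemma wp_WhilePos:
  fixes n :: nat
  assumes "I n V A inp t"
    and "\<And>n V A inp t. I n V A inp t \<Longrightarrow> 0 < V x \<Longrightarrow> wp c (\<lambda>V A inp t. \<exists>m<n. I m V A inp (t + 3)) V A inp t"
    and "\<And>n V A inp t. I n V A inp t \<Longrightarrow> V x = 0 \<Longrightarrow> Q V A inp (t + 3)"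
  shows "wp (WhilePos x c) Q V A inp t"
  using assms(1)
proof (induction n arbitrary: V A inp t rule: less_induct)
  case (less n)
  show ?case
  proof (cases "0 < V x")
    case True
    from assms(2)[OF less.prems True] obtain u V' A' inp' m
      where 1: "big_step c (V, A, inp) u (V', A', inp')" and m: "m < n" "I m V' A' inp' (t + u + 3)"
      unfolding wp_def by blast
    from less.IH[OF m] obtain u' V'' A'' inp''
      where 2: "big_step (WhilePos x c) (V', A', inp') u' (V'', A'', inp'')"
        and Q: "Q V'' A'' inp'' (t + u + 3 + u')"
      unfolding wp_def by blast
    have "t + (u + u' + 3) = t + u + 3 + u'" by simp
    then show ?thesis
      unfolding wp_def using big_step.intros(12)[of V x, OF True 1 2] Q by metis
  next
    case False
    then show ?thesis
      using assms(3)[OF less.prems] big_step.intros(13)[of V x c A inp] unfolding wp_def by blast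
  qed
qed

section \<open>The program\<close>

definition load :: com where
  "load = Copy Cnt Len ;; Zero Pos ;; WhilePos Cnt
     (Succ Pos Pos ;; Input Cur ;; Get Tmp Last Cur ;; Put Prv Pos Tmp ;; Put Nxt Tmp Pos ;;
      Put Last Cur Pos ;; Pred Cnt Cnt)"

definition clear :: com where
  "clear = Zero Tmp ;; Copy Cnt Len ;; WhilePos Cnt
     (Put New Cnt Tmp ;; Put Flip Cnt Tmp ;; Pred Cnt Cnt)"

text \<open>In the second branch \<open>Tmp\<close> is 0, so its successor is the mark 1.
  \<open>Cnt\<close> receives the value \<open>y\<close> of \<open>other_option\<close>; if it is 0,
  the owner has nowhere to go.\<close>

definition flip :: com where
  "flip = Get Tmp Flip Owner ;; IfPos Tmp Skip
     (Succ Tmp Tmp ;; Put Flip Owner Tmp ;; Get Cnt Prv Owner ;; Get Tmp Prv Cnt ;;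
      IfPos Tmp Skip (Get Cnt Nxt Owner) ;;
      IfPos Cnt (Put Queue Tl Cnt ;; Succ Tl Tl) (Zero Ok))"

text \<open>Truncated subtraction serves as the comparisons \<open>Low < Pos\<close> and
  \<open>Hd < Tl\<close>.\<close>

definition advance :: com where
  "advance = Minus Tmp Pos Low ;; IfPos Tmp (Pred Pos Pos)
     (Succ Hd Hd ;; Minus Tmp Tl Hd ;;
      IfPos Tmp (Get End Queue Hd ;; Copy Pos End ;; Get Low Prv End) (Zero Go))"

definition proceed :: com where
  "proceed = IfPos Ok advance (Zero Go)"

definition claim :: com where
  "claim = Get Tmp New Pos ;; IfPos Tmp (Zero Ok ;; Zero Go)
     (Put New Pos End ;; Get Owner Own Pos ;; IfPos Owner flip Skip ;; proceed)"

text \<open>The language has no constant but 0; after \<open>Zero Hd\<close>, a \<open>Succ\<close>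
  applied to \<open>Hd\<close> assigns 1.\<close>

definition search :: com where
  "search = Zero Hd ;; Put Queue Hd End ;; Succ Tl Hd ;; Copy Pos End ;; Succ Ok Hd ;; Succ Go Hd ;;
     WhilePos Go claim"

text \<open>A free position has owner 0. Whatever \<open>Flip\<close> holds at index 0, the entry of
  \<open>Own\<close> stays 0 if the position was not claimed.\<close>

definition commit :: com where
  "commit = Copy Cnt Len ;; WhilePos Cnt
     (Get Tmp New Cnt ;;
      IfPos Tmp (Put Own Cnt Tmp)
        (Get Owner Own Cnt ;; Get Tmp Flip Owner ;; IfPos Tmp (Zero Tmp ;; Put Own Cnt Tmp) Skip) ;;
      Pred Cnt Cnt)"

text \<open>The test of \<open>Low\<close> rejects anything that is not a right end, so that missing
  and first occurrences may be passed in as candidates.\<close>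

definition attempt :: com where
  "attempt = Get Low Prv End ;; IfPos Low (clear ;; search ;; IfPos Ok commit Skip) (Zero Ok)"

definition insert_letters :: com where
  "insert_letters = Zero Cur ;; Succ Ans Cur ;; Copy Todo Alph ;; WhilePos Todo
     (Get End Last Cur ;; attempt ;;
      IfPos Ok Skip (Get End Last Cur ;; Get End Prv End ;; attempt) ;;
      Pred Todo Todo ;; Succ Cur Cur ;;
      IfPos Ok Skip (Zero Ans ;; Zero Todo))"

text \<open>The main loop has up to \<open>\<sigma>\<close> rounds, but time is bounded in the
  length only. The initial comparison ensures that \<open>\<sigma>\<close> is at most the
  length.\<close>

definition FT3 :: com where
  "FT3 = Input Alph ;; Input Len ;; Minus Tmp Alph Len ;;
     IfPos Tmp (Zero Ans) (load ;; insert_letters)"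

section \<open>Occurrence tables and the linear passes\<close>

definition tables :: "nat list \<Rightarrow> nat \<Rightarrow> (arr \<Rightarrow> nat \<Rightarrow> nat) \<Rightarrow> bool" where
  "tables S i A \<longleftrightarrow> (\<forall>k\<le>i. A Prv k = prv S k) \<and> (\<forall>a. A Last a = last_occ S a i) \<and>
     (\<forall>k>0. \<forall>j>0. A Nxt k = j \<longleftrightarrow> j \<le> i \<and> prv S j = k)"

text \<open>For a first occurrence \<open>p = 0\<close>, and the write to \<open>Nxt\<close> goes to
  index 0, which \<open>tables\<close> leaves open. For \<open>p > 0\<close> the entry belongs to
  \<open>Suc i\<close> alone, by \<open>prv_inj\<close>.\<close>

lemma tables_Suc:
  assumes "tables S i A" "p = last_occ S (S ! i) i"
  shows "tables S (Suc i) (A(Prv := (A Prv)(Suc i := p), Nxt := (A Nxt)(p := Suc i),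
    Last := (A Last)(S ! i := Suc i)))"
proof -
  have p: "prv S (Suc i) = p" using assms(2) by (simp add: prv_def letter_def)
  have "((A Nxt)(p := Suc i)) k = j \<longleftrightarrow> j \<le> Suc i \<and> prv S j = k" if "0 < k" "0 < j" for k j
  proof (cases "k = p")
    case True
    then show ?thesis using p prv_inj[of S j "Suc i"] that by auto
  next
    case False
    then show ?thesis using assms(1) that p by (auto simp: tables_def le_Suc_eq)
  qed
  then show ?thesis using assms p by (auto simp: tables_def le_Suc_eq)
qed

lemma load_correct:
  assumes "V Len = length S" "tables S 0 A"
    and Q: "\<And>V' A' inp' t'. V' Len = V Len \<Longrightarrow> V' Alph = V Alph \<Longrightarrow> A' Own = A Own \<Longrightarrow>
      tables S (length S) A' \<Longrightarrow> t' \<le> t + 40 * length S + 10 \<Longrightarrow> Q V' A' inp' t'"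
  shows "wp load Q V A S t"
proof -
  \<comment> \<open>Time is kept as a budget: elapsed time plus 40 for each outstanding round stays
    bounded. A round takes 29 steps, and the loop adds 3.\<close>
  define I where "I = (\<lambda>m (V' :: var \<Rightarrow> nat) A' inp' t'. m = V' Cnt \<and> V' Cnt \<le> length S \<and>
    V' Pos = length S - V' Cnt \<and> V' Len = V Len \<and> V' Alph = V Alph \<and> A' Own = A Own \<and>
    inp' = drop (V' Pos) S \<and> tables S (V' Pos) A' \<and> t' + 40 * m \<le> t + 40 * length S + 3)"
  show ?thesis
    unfolding load_def wp_simps
  proof (rule wp_WhilePos[where I = I and n = "length S"])
    show "I (length S) (V(Cnt := V Len, Pos := 0)) A S (t + 2 + 1)"
      using assms by (simp add: I_def)
  next
    fix n V' A' inp' t'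
    assume I: "I n V' A' inp' t'" and pos: "0 < V' Cnt"
    let ?i = "V' Pos"
    have i: "?i < length S" using I pos by (auto simp: I_def)
    then have "inp' = S ! ?i # drop (Suc ?i) S" using I by (simp add: I_def Cons_nth_drop_Suc)
    moreover have "A' Last (S ! ?i) = last_occ S (S ! ?i) ?i" using I by (simp add: I_def tables_def)
    ultimately show "wp (Succ Pos Pos ;; Input Cur ;; Get Tmp Last Cur ;; Put Prv Pos Tmp ;;
        Put Nxt Tmp Pos ;; Put Last Cur Pos ;; Pred Cnt Cnt)
        (\<lambda>V A inp t. \<exists>m<n. I m V A inp (t + 3)) V' A' inp' t'"
      using I pos i tables_Suc[of S ?i A' "last_occ S (S ! ?i) ?i"]
      by (simp add: wp_simps) (auto simp: I_def)
  next
    fix n V' A' inp' t'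
    assume "I n V' A' inp' t'" "V' Cnt = 0"
    then show "Q V' A' inp' (t' + 3)" by (intro Q) (auto simp: I_def)
  qed
qed

lemma clear_correct:
  assumes "V Len = n"
    and Q: "\<And>V' A' t'. \<forall>x. x \<notin> {Tmp, Cnt} \<longrightarrow> V' x = V x \<Longrightarrow> \<forall>f. f \<notin> {New, Flip} \<longrightarrow> A' f = A f \<Longrightarrow>
      \<forall>j\<in>{1..n}. A' New j = 0 \<Longrightarrow> \<forall>j\<in>{1..n}. A' Flip j = 0 \<Longrightarrow> t' \<le> t + 20 * n + 10 \<Longrightarrow> Q V' A' inp t'"
  shows "wp clear Q V A inp t"
proof -
  define I where "I = (\<lambda>m (V' :: var \<Rightarrow> nat) A' inp' t'. m = V' Cnt \<and> V' Cnt \<le> n \<and> V' Tmp = 0 \<and> inp' = inp \<and>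
    (\<forall>x. x \<notin> {Tmp, Cnt} \<longrightarrow> V' x = V x) \<and> (\<forall>f. f \<notin> {New, Flip} \<longrightarrow> A' f = A f) \<and>
    (\<forall>j\<in>{m<..n}. A' New j = 0 \<and> A' Flip j = 0) \<and> t' + 20 * m \<le> t + 20 * n + 3)"
  show ?thesis
    unfolding clear_def wp_simps
  proof (rule wp_WhilePos[where I = I and n = n])
    show "I n (V(Tmp := 0, Cnt := (V(Tmp := 0)) Len)) A inp (t + 1 + 2)"
      using assms(1) by (simp add: I_def)
  next
    fix m V' A' inp' t'
    assume I: "I m V' A' inp' t'" and pos: "0 < V' Cnt"
    have "\<forall>j\<in>{m - 1<..n}. ((A' New)(m := 0)) j = 0 \<and> ((A' Flip)(m := 0)) j = 0"
      using I by (auto simp: I_def)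
    then show "wp (Put New Cnt Tmp ;; Put Flip Cnt Tmp ;; Pred Cnt Cnt)
        (\<lambda>V A inp t. \<exists>m'<m. I m' V A inp (t + 3)) V' A' inp' t'"
      using I pos by (auto simp: wp_simps I_def)
  next
    fix m V' A' inp' t'
    assume I: "I m V' A' inp' t'" and "V' Cnt = 0"
    then have "inp' = inp" by (simp add: I_def)
    then show "Q V' A' inp' (t' + 3)"
      using I \<open>V' Cnt = 0\<close> Q[of V' A' "t' + 3"] by (simp add: I_def greaterThanAtMost_def atLeastAtMost_def)
  qed
qed

lemma commit_correct:
  assumes "V Len = n"
    and Q: "\<And>V' A' t'. \<forall>x. x \<notin> {Tmp, Cnt, Owner} \<longrightarrow> V' x = V x \<Longrightarrow> \<forall>f. f \<noteq> Own \<longrightarrow> A' f = A f \<Longrightarrow>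
      \<forall>k\<in>{1..n}. A' Own k = (if A New k > 0 then A New k else if A Flip (A Own k) > 0 then 0 else A Own k) \<Longrightarrow>
      t' \<le> t + 50 * n + 10 \<Longrightarrow> Q V' A' inp t'"
  shows "wp commit Q V A inp t"
proof -
  let ?own = "\<lambda>k. if A New k > 0 then A New k else if A Flip (A Own k) > 0 then 0 else A Own k"
  define I where "I = (\<lambda>m (V' :: var \<Rightarrow> nat) A' inp' t'. m = V' Cnt \<and> V' Cnt \<le> n \<and> inp' = inp \<and>
    (\<forall>x. x \<notin> {Tmp, Cnt, Owner} \<longrightarrow> V' x = V x) \<and> (\<forall>f. f \<noteq> Own \<longrightarrow> A' f = A f) \<and>
    (\<forall>k. A' Own k = (if k \<in> {m<..n} then ?own k else A Own k)) \<and> t' + 50 * m \<le> t + 50 * n + 3)"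
  show ?thesis
    unfolding commit_def wp_simps
  proof (rule wp_WhilePos[where I = I and n = n])
    show "I n (V(Cnt := V Len)) A inp (t + 2)"
      using assms(1) by (simp add: I_def)
  next
    fix m V' A' inp' t'
    assume I: "I m V' A' inp' t'" and pos: "0 < V' Cnt"
    then have m: "0 < m" "m \<le> n" "V' Cnt = m" by (auto simp: I_def)
    have own: "\<forall>k. ((A' Own)(m := ?own m)) k = (if k \<in> {m - 1<..n} then ?own k else A Own k)"
      using I m by (auto simp: I_def)
    \<comment> \<open>The loop runs downwards and writes \<open>Own\<close> only at
      \<open>Cnt\<close>, so the entry at \<open>m\<close> is still the original one when it is
      read.\<close>
    have eq: "A' Own m = A Own m" "A' New = A New" "A' Flip = A Flip" using I m by (auto simp: I_def)
    have step: "\<exists>m'<m. I m' V'' A'' inp' t''"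
      if "V'' Cnt = m - 1" "\<forall>x. x \<notin> {Tmp, Cnt, Owner} \<longrightarrow> V'' x = V' x" "\<forall>f. f \<noteq> Own \<longrightarrow> A'' f = A' f"
        "A'' Own = (A' Own)(m := ?own m)" "t'' \<le> t' + 43" for V'' A'' t''
    proof (intro exI[of _ "m - 1"] conjI)
      have "t'' + 50 * (m - 1) \<le> t + 50 * n + 3" using that(5) I m by (cases m) (auto simp: I_def)
      then show "I (m - 1) V'' A'' inp' t''" using that(1-4) I m own by (simp add: I_def)
    qed (use m in simp)
    show "wp (Get Tmp New Cnt ;;
      IfPos Tmp (Put Own Cnt Tmp)
        (Get Owner Own Cnt ;; Get Tmp Flip Owner ;; IfPos Tmp (Zero Tmp ;; Put Own Cnt Tmp) Skip) ;;
      Pred Cnt Cnt)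
        (\<lambda>V A inp t. \<exists>m'<m. I m' V A inp (t + 3)) V' A' inp' t'"
      \<comment> \<open>If neither write takes place, \<open>fun_upd_triv\<close> presents the
        unchanged \<open>Own\<close> as an update, as \<open>step\<close> expects.\<close>
      using fun_upd_triv[of "A' Own" m]
      by (cases "A New m > 0"; cases "A Flip (A Own m) > 0") (auto simp: wp_simps m(3) eq split: if_splits intro!: step)
  next
    fix m V' A' inp' t'
    assume I: "I m V' A' inp' t'" and "V' Cnt = 0"
    then have "inp' = inp" by (simp add: I_def)
    then show "Q V' A' inp' (t' + 3)"
      using I \<open>V' Cnt = 0\<close> Q[of V' A' "t' + 3"] by (simp add: I_def)
  qed
qed

section \<open>Execution of a single insertion\<close>

definition same_vars :: "(var \<Rightarrow> nat) \<Rightarrow> (var \<Rightarrow> nat) \<Rightarrow> bool" where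
  "same_vars V V' \<longleftrightarrow> (\<forall>x\<in>{Ans, Alph, Len, Cur, Todo}. V' x = V x)"

definition same_arrs :: "(arr \<Rightarrow> nat \<Rightarrow> nat) \<Rightarrow> (arr \<Rightarrow> nat \<Rightarrow> nat) \<Rightarrow> bool" where
  "same_arrs A A' \<longleftrightarrow> (\<forall>f\<in>{Last, Prv, Nxt}. A' f = A f)"

definition queue :: "(var \<Rightarrow> nat) \<Rightarrow> (arr \<Rightarrow> nat \<Rightarrow> nat) \<Rightarrow> nat list" where
  "queue V A = map (A Queue) [0..<V Tl]"

locale FT3_insertion = insertion S C B e0 own
  for S :: "nat list" and C B e0 own +
  assumes count: "count_list S a \<le> 3"
begin

text \<open>\<open>Go\<close> and \<open>Ok\<close> encode three states: running, stopped with all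
  queued intervals claimed, and failed. While running, \<open>Pos\<close> is the next position to be
  claimed, whence the limit \<open>Suc (V Pos)\<close>.\<close>

definition searching :: "(var \<Rightarrow> nat) \<Rightarrow> (arr \<Rightarrow> nat \<Rightarrow> nat) \<Rightarrow> bool" where
  "searching V A \<longleftrightarrow>
     (if 0 < V Go then
        0 < V Ok \<and> trial (queue V A) (V Hd) (Suc (V Pos)) (A New) (A Flip) \<and>
        V End = queue V A ! V Hd \<and> V Low = prv S (V End) \<and> V Pos \<in> ival S (V End)
      else if 0 < V Ok then
        \<exists>ds h. Suc h = length ds \<and> trial ds h (prv S (ds ! h)) (A New) (A Flip)
      else excluded S B e0)"

text \<open>A round either claims a fresh position or meets a claimed one. The latter leaves the
  count unchanged but clears \<open>Go\<close>, which the extra summand accounts for.\<close>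

definition remaining :: "(var \<Rightarrow> nat) \<Rightarrow> (arr \<Rightarrow> nat \<Rightarrow> nat) \<Rightarrow> nat" where
  "remaining V A = card {j\<in>{1..length S}. A New j = 0} + (if 0 < V Go then 1 else 0)"

lemma advance_correct:
  assumes trial: "trial (queue V A) (V Hd) (V Pos) (A New) (A Flip)"
    and V: "V End = queue V A ! V Hd" "V Low = prv S (V End)" "V Pos \<in> ival S (V End)" "0 < V Go" "0 < V Ok"
    and prv: "\<forall>k\<le>length S. A Prv k = prv S k"
  shows "wp advance (\<lambda>V' A' inp' t'. A' = A \<and> inp' = inp \<and> t' \<le> t + 30 \<and> same_vars V V' \<and> searching V' A') V A inp t"
proof (cases "V Low < V Pos")
  case True
  then have "V Pos - 1 \<in> ival S (V End)" "Suc (V Pos - 1) = V Pos" using V by (auto simp: ival_def)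
  then show ?thesis using True V trial
    by (simp add: advance_def wp_simps same_vars_def searching_def queue_def)
next
  case False
  then have pos: "V Pos = prv S (queue V A ! V Hd)" using V by (auto simp: ival_def)
  note trial' = trial[unfolded pos]
  have h: "V Hd < V Tl" using trialD(1)[OF trial] by (simp add: queue_def)
  show ?thesis
  proof (cases "Suc (V Hd) < V Tl")
    case True
    then have adv: "trial (queue V A) (Suc (V Hd)) (Suc (queue V A ! Suc (V Hd))) (A New) (A Flip)"
      using trial_advance[OF trial'] by (simp add: queue_def)
    have e: "A Queue (Suc (V Hd)) = queue V A ! Suc (V Hd)"
      using True by (simp add: queue_def del: upt_Suc)
    have "queue V A ! Suc (V Hd) \<in> right_ends S" using current_end(2)[OF adv] .
    then have r: "queue V A ! Suc (V Hd) \<in> ival S (queue V A ! Suc (V Hd))"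
      "queue V A ! Suc (V Hd) \<le> length S"
      using right_end_in_ival right_endsD(4) by auto
    have q: "queue (V(x := v)) A = queue V A" if "x \<noteq> Tl" for x v V using that by (simp add: queue_def)
    show ?thesis using False True V(4,5) adv e r prv
      by (simp add: advance_def wp_simps same_vars_def searching_def q)
  next
    case last: False
    then have "Suc (V Hd) = length (queue V A)" using h by (simp add: queue_def)
    then show ?thesis using False last V(5) trial'
      by (auto simp: advance_def wp_simps same_vars_def searching_def)
  qed
qed

lemma claim_correct:
  assumes "searching V A" "0 < V Go" and tab: "tables S (length S) A" and own: "A Own = own"
  shows "wp claim (\<lambda>V' A' inp' t'. inp' = inp \<and> t' \<le> t + 110 \<and> same_vars V V' \<and> same_arrs A A' \<and>
    A' Own = own \<and> searching V' A' \<and> remaining V' A' < remaining V A) V A inp t"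
proof -
  let ?k = "V Pos" and ?e = "V End" and ?ds = "queue V A" and ?h = "V Hd"
  have trial: "trial ?ds ?h (Suc ?k) (A New) (A Flip)" and V: "0 < V Ok" "?e = ?ds ! ?h"
    "V Low = prv S ?e" "?k \<in> ival S ?e"
    using assms(1,2) by (auto simp: searching_def)
  note k = V(4)[unfolded V(2)]
  have e: "?e \<in> right_ends S" "0 < ?e" using current_end[OF trial] V(2) by auto
  have kS: "?k \<in> {1..length S}" using V(4) ival_subset[OF e(1)] by blast
  have prv: "\<forall>k\<le>length S. A Prv k = prv S k" using tab by (simp add: tables_def)
  have less: "card {j\<in>{1..length S}. ((A New)(?k := ?e)) j = 0} < card {j\<in>{1..length S}. A New j = 0}"
    if "A New ?k = 0"
    by (rule psubset_card_mono) (use that kS e(2) in auto)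
  define Q where "Q = (\<lambda>V' A' inp' t'. inp' = inp \<and> t' \<le> t + 110 \<and> same_vars V V' \<and> same_arrs A A' \<and>
    A' Own = own \<and> searching V' A' \<and> remaining V' A' < remaining V A)"
  \<comment> \<open>A free position, an owner already flipped and an owner just flipped all end in
    \<open>proceed\<close>. The queue is that of the new state, as the last case extends it. The 75
    steps so far, the test and 30 steps of \<open>advance\<close> stay within 110.\<close>
  have finish: "wp proceed Q V' A' inp t'"
    if new: "A New ?k = 0" and A': "A' New = (A New)(?k := ?e)" "same_arrs A A'" "A' Own = own"
      and V': "same_vars V V'" "\<forall>x\<in>{End, Low, Pos, Go, Ok, Hd}. V' x = V x"
      and trial': "trial (queue V' A') ?h ?k (A' New) (A' Flip)" "queue V' A' ! ?h = ?e" and t': "t' \<le> t + 75"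
    for V' A' t'
  proof -
    have "\<forall>k\<le>length S. A' Prv k = prv S k" using prv A'(2) by (simp add: same_arrs_def)
    then have "wp advance (\<lambda>V'' A'' inp'' t''. A'' = A' \<and> inp'' = inp \<and> t'' \<le> t' + 1 + 30 \<and> same_vars V' V'' \<and>
        searching V'' A'') V' A' inp (t' + 1)"
      using trial' V' V assms(2) by (intro advance_correct) auto
    then have "wp advance Q V' A' inp (t' + 1)"
      by (rule wp_mono) (use A' V' t' less[OF new] assms(2) in \<open>auto simp: Q_def same_vars_def remaining_def\<close>)
    then show ?thesis using V' V(1) by (simp add: proceed_def wp_simps)
  qed
  have "wp claim Q V A inp t"
  proof (cases "A New ?k = 0")
    case False
    then have "excluded S B e0" using conflict_excluded[OF trial k] by simp
    then show ?thesis using False assms(2) own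
      by (simp add: claim_def wp_simps Q_def same_vars_def same_arrs_def searching_def remaining_def)
  next
    case new: True
    let ?A = "A(New := (A New)(?k := ?e))" and ?r = "own ?k"
    show ?thesis
    proof (cases "?r = 0 \<or> A Flip ?r > 0")
      case True
      have "trial ?ds ?h ?k ((A New)(?k := ?e)) (A Flip)"
        using trial_claim[OF trial k new True] V(2) by simp
      then have fin: "wp proceed Q V' ?A inp t'"
        if "same_vars V V'" "\<forall>x\<in>{End, Low, Pos, Go, Ok, Hd, Tl}. V' x = V x" "t' \<le> t + 75" for V' t'
        by (intro finish) (use that new own V(2) in \<open>auto simp: same_arrs_def queue_def\<close>)
      show ?thesis
      proof (cases "?r = 0")
        case True
        then show ?thesis
          by (simp add: claim_def wp_simps new own) (intro fin; simp add: same_vars_def)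
      next
        case False
        then have "0 < ?r" "0 < A Flip ?r" using True by auto
        then show ?thesis
          by (simp add: claim_def flip_def wp_simps new own) (intro fin; simp add: same_vars_def)
      qed
    next
      case False
      then have r: "0 < ?r" "A Flip ?r = 0" by auto
      have "?r \<in> C" using ownsD[OF owns_C kS r(1)] by simp
      then have rE: "?r \<in> right_ends S" using C_simps(1) by blast
      note rd = right_endsD[OF rE]
      \<comment> \<open>The value that \<open>flip\<close> leaves in \<open>Cnt\<close>.\<close>
      define y where "y = (if prv S (prv S ?r) > 0 then prv S ?r else A Nxt ?r)"
      have opt: "options S (letter S ?r) = (if y > 0 then {?r, y} else {?r}) \<and> y \<noteq> ?r"
        by (rule other_option[OF count rE _ y_def]) (use tab rd in \<open>simp add: tables_def\<close>)
      have P: "A Prv ?r = prv S ?r" "A Prv (prv S ?r) = prv S (prv S ?r)"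
        using prv rd by auto
      show ?thesis
      proof (cases "y = 0")
        case True
        then have "excluded S B e0" using stuck_excluded[OF trial k refl r(1)] opt by simp
        from True have "prv S (prv S ?r) = 0" "A Nxt ?r = 0"
          using rd unfolding y_def by (auto split: if_splits)
        then show ?thesis using \<open>excluded S B e0\<close> less[OF new] assms(2)
          by (simp add: claim_def flip_def proceed_def wp_simps new own r P)
             (simp add: Q_def same_vars_def same_arrs_def searching_def remaining_def own)
      next
        case False
        then have trial': "trial (?ds @ [y]) ?h ?k ((A New)(?k := ?e)) ((A Flip)(?r := 1))"
          using trial_claim_flip[OF trial k new refl r] opt V(2) by auto
        define A' where "A' = A(New := (A New)(?k := ?e), Flip := (A Flip)(?r := Suc 0), Queue := (A Queue)(V Tl := y))"
        have q': "queue V' A' = ?ds @ [y]" if "V' Tl = Suc (V Tl)" for V'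
          using that by (simp add: queue_def A'_def)
        have h: "(?ds @ [y]) ! ?h = ?e" using trialD(1)[OF trial] V(2) by (simp add: nth_append)
        have fin: "wp proceed Q V' A' inp t'"
          if "same_vars V V'" "\<forall>x\<in>{End, Low, Pos, Go, Ok, Hd}. V' x = V x" "V' Tl = Suc (V Tl)" "t' \<le> t + 75"
          for V' t'
          by (rule finish) (use that new own q'[of V'] trial' h in \<open>auto simp: A'_def same_arrs_def\<close>)
        show ?thesis
        proof (cases "prv S (prv S ?r) = 0")
          case True
          then have "A Nxt ?r = y" by (simp add: y_def)
          then show ?thesis using True False
            by (simp add: claim_def flip_def wp_simps new own r P)
               (intro fin[unfolded A'_def]; simp add: same_vars_def)
        next
          case notfirst: False
          then have y: "y = prv S ?r" by (simp add: y_def)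
          show ?thesis using notfirst rd
            by (simp add: claim_def flip_def wp_simps new own r P)
               (intro fin[unfolded A'_def y]; simp add: same_vars_def)
        qed
      qed
    qed
  qed
  then show ?thesis by (simp add: Q_def)
qed

end

context FT3_insertion
begin

lemma search_correct:
  assumes V: "V End = e0" "V Low = prv S e0" and tab: "tables S (length S) A" and own: "A Own = own"
    and zero: "\<forall>j\<in>{1..length S}. A New j = 0" "\<forall>j\<in>{1..length S}. A Flip j = 0"
    and Q: "\<And>V' A' t'. same_vars V V' \<Longrightarrow> same_arrs A A' \<Longrightarrow> A' Own = own \<Longrightarrow> V' Go = 0 \<Longrightarrow>
      searching V' A' \<Longrightarrow> t' \<le> t + 120 * length S + 150 \<Longrightarrow> Q V' A' inp t'"
  shows "wp search Q V A inp t"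
proof -
  \<comment> \<open>There may be one round more than positions; this round and the 15 steps of
    initialization are covered by the constant 145.\<close>
  define I where "I = (\<lambda>m V' A' inp' t'. m = remaining V' A' \<and> inp' = inp \<and> same_vars V V' \<and> same_arrs A A' \<and>
    A' Own = own \<and> searching V' A' \<and> t' + 120 * m \<le> t + 120 * length S + 145)"
  let ?V = "V(Hd := 0, Tl := 1, Pos := e0, Ok := 1, Go := 1)"
  let ?A = "A(Queue := (A Queue)(0 := e0))"
  have q: "queue ?V ?A = [e0]" by (simp add: queue_def)
  have "searching ?V ?A"
    using trial_init[OF zero] V right_end_in_ival[OF e0_end] q by (simp add: searching_def)
  moreover have "remaining ?V ?A \<le> Suc (length S)"
  proof -
    have "card {j\<in>{1..length S}. A New j = 0} \<le> card {1..length S}" by (rule card_mono) auto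
    then show ?thesis by (simp add: remaining_def)
  qed
  ultimately have init: "I (remaining ?V ?A) ?V ?A inp (15 + t)"
    using own by (auto simp: I_def same_vars_def same_arrs_def)
  have "wp (WhilePos Go claim) Q ?V ?A inp (15 + t)"
  proof (rule wp_WhilePos[where I = I, OF init])
    fix m V' A' inp' t'
    assume I: "I m V' A' inp' t'" and go: "0 < V' Go"
    have tab': "tables S (length S) A'" using tab I by (simp add: I_def same_arrs_def tables_def)
    have "wp claim (\<lambda>V'' A'' inp'' t''. inp'' = inp' \<and> t'' \<le> t' + 110 \<and> same_vars V' V'' \<and> same_arrs A' A'' \<and>
        A'' Own = own \<and> searching V'' A'' \<and> remaining V'' A'' < remaining V' A') V' A' inp' t'"
      using I go tab' by (intro claim_correct) (auto simp: I_def)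
    then show "wp claim (\<lambda>V A inp t. \<exists>m'<m. I m' V A inp (t + 3)) V' A' inp' t'"
      by (rule wp_mono) (use I in \<open>auto simp: I_def same_vars_def same_arrs_def\<close>)
  next
    fix m V' A' inp' t'
    assume I: "I m V' A' inp' t'" and "V' Go = 0"
    then have "inp' = inp" by (simp add: I_def)
    then show "Q V' A' inp' (t' + 3)" using I \<open>V' Go = 0\<close> by (intro Q[of V' A' "t' + 3", folded \<open>inp' = inp\<close>]) (auto simp: I_def)
  qed
  then show ?thesis using V by (simp add: search_def wp_simps)
qed

end

text \<open>On failure \<open>Own\<close> is unchanged, since the search writes its claims and marks
  to \<open>New\<close> and \<open>Flip\<close> only; the other candidate can then start from the
  same \<open>C\<close>. On success \<open>Own\<close> describes the choice of
  \<open>trial_finish\<close>.\<close>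

lemma attempt_correct:
  assumes count: "\<And>a. count_list S a \<le> 3" and len: "V Len = length S" and tab: "tables S (length S) A"
    and C: "valid S C B" "owns S C (A Own)"
    and e: "V End \<le> length S" "V End \<in> right_ends S \<Longrightarrow> letter S (V End) \<notin> B"
    and Q: "\<And>V' A' t'. same_vars V V' \<Longrightarrow> same_arrs A A' \<Longrightarrow> t' \<le> t + 200 * length S + 300 \<Longrightarrow>
      (if 0 < V' Ok then V End \<in> right_ends S \<and> (\<exists>C'. valid S C' (insert (letter S (V End)) B) \<and> owns S C' (A' Own))
       else A' Own = A Own \<and> excluded S B (V End)) \<Longrightarrow> Q V' A' inp t'"
  shows "wp attempt Q V A inp t"
proof (cases "V End \<in> right_ends S")
  case False
  \<comment> \<open>Valid choices consist of right ends, so any other position is excluded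
    trivially.\<close>
  then have "excluded S B (V End)" by (auto simp: excluded_def valid_def)
  moreover have "prv S (V End) = 0" using False e(1) by (simp add: right_ends_def)
  moreover have "A Prv (V End) = prv S (V End)" using tab e(1) by (simp add: tables_def)
  ultimately show ?thesis
    by (simp add: attempt_def wp_simps) (intro Q; simp add: same_vars_def same_arrs_def)
next
  case True
  interpret FT3_insertion S C B "V End" "A Own"
    by unfold_locales (use C True e(2) count in auto)
  have low: "A Prv (V End) = prv S (V End)" "0 < prv S (V End)"
    using tab e(1) right_endsD[OF True] by (auto simp: tables_def)
  let ?V = "V(Low := prv S (V End))"
  have "wp clear (wp search (wp (IfPos Ok commit Skip) Q)) ?V A inp (7 + t)"
  proof (rule clear_correct[of _ "length S"])
    fix V1 A1 t1
    assume V1: "\<forall>x. x \<notin> {Tmp, Cnt} \<longrightarrow> V1 x = ?V x" and A1: "\<forall>f. f \<notin> {New, Flip} \<longrightarrow> A1 f = A f"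
      and zero: "\<forall>j\<in>{1..length S}. A1 New j = 0" "\<forall>j\<in>{1..length S}. A1 Flip j = 0"
      and t1: "t1 \<le> 7 + t + 20 * length S + 10"
    show "wp search (wp (IfPos Ok commit Skip) Q) V1 A1 inp t1"
    proof (rule search_correct[OF _ _ _ _ zero])
      show "V1 End = V End" "V1 Low = prv S (V End)" "A1 Own = A Own" "tables S (length S) A1"
        using V1 A1 tab by (auto simp: tables_def)
    next
      fix V2 A2 t2
      assume V2: "same_vars V1 V2" and A2: "same_arrs A1 A2" "A2 Own = A Own" and go: "V2 Go = 0"
        and s: "searching V2 A2" and t2: "t2 \<le> t1 + 120 * length S + 150"
      have V02: "same_vars V V2" using V1 V2 by (simp add: same_vars_def)
      have A02: "same_arrs A A2" using A1 A2 by (simp add: same_arrs_def)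
      show "wp (IfPos Ok commit Skip) Q V2 A2 inp t2"
      proof (cases "0 < V2 Ok")
        case False
        then have "excluded S B (V End)" using s go by (simp add: searching_def)
        then have "Q V2 A2 inp (t2 + 3)"
          using V02 A02 False A2(2) t1 t2 by (intro Q) auto
        then show ?thesis using False by (simp add: wp_simps)
      next
        case ok: True
        then obtain ds h where ds: "Suc h = length ds" "trial ds h (prv S (ds ! h)) (A2 New) (A2 Flip)"
          using s go by (auto simp: searching_def)
        have "wp commit Q V2 A2 inp (t2 + 1)"
        proof (rule commit_correct[of _ "length S"])
          show "V2 Len = length S" using V02 len by (simp add: same_vars_def)
        next
          fix V3 A3 t3
          assume V3: "\<forall>x. x \<notin> {Tmp, Cnt, Owner} \<longrightarrow> V3 x = V2 x" and A3: "\<forall>f. f \<noteq> Own \<longrightarrow> A3 f = A2 f"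
            "\<forall>k\<in>{1..length S}. A3 Own k =
              (if A2 New k > 0 then A2 New k else if A2 Flip (A2 Own k) > 0 then 0 else A2 Own k)"
            and t3: "t3 \<le> t2 + 1 + 50 * length S + 10"
          have "\<exists>C'. valid S C' (insert (letter S (V End)) B) \<and> owns S C' (A3 Own)"
            using A3(2) A2(2) by (intro trial_finish[OF ds(2,1)]) simp
          moreover have "same_vars V V3" using V02 V3 by (simp add: same_vars_def)
          moreover have "same_arrs A A3" using A02 A3(1) by (simp add: same_arrs_def)
          moreover have "0 < V3 Ok" using V3 ok by simp
          ultimately show "Q V3 A3 inp t3" using t1 t2 t3 True by (intro Q) auto
        qed
        then show ?thesis using ok by (simp add: wp_simps)
      qed
    qed
  qed (use len in simp)
  then show ?thesis using low by (simp add: attempt_def wp_Seq wp_basic wp_IfPos[of Low])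
qed

text \<open>The invariant has two alternatives: a valid choice for all letters below
  \<open>Cur\<close>, or a negative answer with the loop about to end. The second is justified when
  both candidates of a letter are excluded, as by \<open>options_subset\<close> there is no
  third.\<close>

lemma insert_letters_correct:
  assumes count: "\<And>a. count_list S a \<le> 3" and V: "V Len = length S" "V Alph = \<sigma>"
    and tab: "tables S (length S) A" and own: "\<And>k. A Own k = 0"
    and Q: "\<And>V' A' inp' t'. V' Ans = (if \<exists>C. valid S C {..<\<sigma>} then 1 else 0) \<Longrightarrow>
      t' \<le> t + (400 * length S + 700) * \<sigma> + 20 \<Longrightarrow> Q V' A' inp' t'"
  shows "wp insert_letters Q V A inp t"
proof -
  let ?n = "length S"
  \<comment> \<open>Two executions of \<open>attempt\<close> at \<open>200 * ?n + 300\<close> steps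
    each, and 100 for the code around them.\<close>
  let ?K = "400 * ?n + 700"
  define I where "I = (\<lambda>m (V' :: var \<Rightarrow> nat) A' (inp' :: nat list) t'. m = V' Todo \<and> V' Len = ?n \<and>
    tables S ?n A' \<and> t' + ?K * m \<le> t + ?K * \<sigma> + 10 \<and>
    (V' Ans = 1 \<and> V' Cur + V' Todo = \<sigma> \<and> (\<exists>C. valid S C {..<V' Cur} \<and> owns S C (A' Own)) \<or>
     V' Ans = 0 \<and> V' Todo = 0 \<and> (\<nexists>C. valid S C {..<\<sigma>})))"
  have "valid S {} {..<0::nat}" "owns S {} (A Own)"
    using own by (auto simp: valid_def owns_def)
  then have init: "I \<sigma> (V(Cur := 0, Ans := 1, Todo := \<sigma>)) A inp (t + 5)"
    using V tab by (auto simp: I_def)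
  let ?rest = "Pred Todo Todo ;; Succ Cur Cur ;; IfPos Ok Skip (Zero Ans ;; Zero Todo)"
  let ?retry = "IfPos Ok Skip (Get End Last Cur ;; Get End Prv End ;; attempt)"
  have "wp (WhilePos Todo (Get End Last Cur ;; attempt ;; ?retry ;; ?rest)) Q
    (V(Cur := 0, Ans := 1, Todo := \<sigma>)) A inp (t + 5)"
  proof (rule wp_WhilePos[where I = I, OF init])
    fix m V' A' inp' t'
    assume I: "I m V' A' inp' t'" and pos: "0 < V' Todo"
    define a where "a = V' Cur"
    define l where "l = last_occ S a ?n"
    let ?Q = "\<lambda>V A inp t. \<exists>m'<m. I m' V A inp (t + 3)"
    obtain C where C: "valid S C {..<a}" "owns S C (A' Own)" and tab': "tables S ?n A'"
      and V': "V' Todo = m" "0 < m" "V' Len = ?n" "V' Ans = 1" "a + m = \<sigma>"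
      and t': "t' + ?K * m \<le> t + ?K * \<sigma> + 10"
      using I pos by (auto simp: I_def a_def)
    have l: "A' Last a = l" "l \<le> ?n" using tab' last_occ_le by (auto simp: tables_def l_def)
    then have pl: "A' Prv l = prv S l" using tab' by (simp add: tables_def)
    have pl': "prv S l \<le> ?n" using l(2) prv_less[of S l] by (cases "prv S l = 0") auto
    have ll: "letter S l = a" if "0 < l" using that unfolding l_def by (rule last_occ_letter)
    have lp: "letter S (prv S l) = a" if "0 < prv S l" using that prv_letter[OF that] prv_less[OF that] ll by simp
    have rest: "wp ?rest ?Q V2 A2 inp' t2"
      if V2: "same_vars V' V2" and A2: "same_arrs A' A2" and t2: "t2 \<le> t' + 400 * ?n + 640"
        and out: "if 0 < V2 Ok then \<exists>C'. valid S C' (insert a {..<a}) \<and> owns S C' (A2 Own)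
          else \<nexists>C. valid S C {..<\<sigma>}" for V2 A2 t2
    proof -
      have tab2: "tables S ?n A2" using tab' A2 by (simp add: same_arrs_def tables_def)
      have K: "?K * m = ?K * (m - 1) + ?K" using V'(2) by (cases m) auto
      have time: "t2 + 20 + ?K * (m - 1) \<le> t + ?K * \<sigma> + 10" using t2 t' K by linarith
      show ?thesis
      proof (cases "0 < V2 Ok")
        case True
        then obtain C' where "valid S C' {..<Suc a}" "owns S C' (A2 Own)"
          using out by (auto simp: lessThan_Suc)
        then have "I (m - 1) (V2(Todo := m - 1, Cur := Suc a)) A2 inp' (t2 + 8)"
          using V2 V' tab2 time unfolding I_def a_def by (auto simp: same_vars_def)
        then show ?thesis using True V2 V'(1,2)
          by (simp add: wp_simps same_vars_def a_def) (intro exI[of _ "m - 1"], simp add: ac_simps)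
      next
        case False
        have "t2 + 12 + ?K * 0 \<le> t + ?K * \<sigma> + 10" using time by linarith
        then have "I 0 (V2(Todo := 0, Cur := Suc a, Ans := 0)) A2 inp' (t2 + 12)"
          using V2 V' tab2 False out unfolding I_def by (auto simp: same_vars_def)
        then show ?thesis using False V2 V'(1,2)
          by (simp add: wp_simps same_vars_def a_def) (intro exI[of _ 0], simp add: ac_simps fun_upd_twist)
      qed
    qed
    have "wp attempt (wp ?retry (wp ?rest ?Q)) (V'(End := l)) A' inp' (t' + 6)"
    proof (rule attempt_correct[OF count _ tab' C])
      show "letter S ((V'(End := l)) End) \<notin> {..<a}" if "(V'(End := l)) End \<in> right_ends S"
        using ll right_endsD(3)[OF that] by simp
    next
      fix V1 A1 t1
      assume V1: "same_vars (V'(End := l)) V1" and A1: "same_arrs A' A1"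
        and t1: "t1 \<le> t' + 6 + 200 * ?n + 300"
        and out1: "if 0 < V1 Ok then (V'(End := l)) End \<in> right_ends S \<and>
            (\<exists>C'. valid S C' (insert (letter S ((V'(End := l)) End)) {..<a}) \<and> owns S C' (A1 Own))
          else A1 Own = A' Own \<and> excluded S {..<a} ((V'(End := l)) End)"
      have V1': "same_vars V' V1" using V1 by (simp add: same_vars_def)
      show "wp ?retry (wp ?rest ?Q) V1 A1 inp' t1"
      proof (cases "0 < V1 Ok")
        case True
        then obtain C' where C': "valid S C' (insert (letter S l) {..<a})" "owns S C' (A1 Own)"
          and "l \<in> right_ends S"
          using out1 by auto
        then have "letter S l = a" using ll right_endsD(3) by blast
        then have "wp ?rest ?Q V1 A1 inp' (t1 + 1)"
          using V1' A1 True C' t1 by (intro rest) auto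
        then show ?thesis using True by (simp add: wp_IfPos[of Ok] wp_basic(1))
      next
        case False
        then have ex1: "A1 Own = A' Own" "excluded S {..<a} l" using out1 by auto
        have tab1: "tables S ?n A1" using tab' A1 by (simp add: same_arrs_def tables_def)
        let ?V1 = "V1(End := prv S l)"
        have "wp attempt (wp ?rest ?Q) ?V1 A1 inp' (t1 + 15)"
        proof (rule attempt_correct[OF count _ tab1 C(1)])
          show "?V1 Len = ?n" using V1' V' by (simp add: same_vars_def)
          show "owns S C (A1 Own)" using C(2) ex1 by simp
          show "?V1 End \<le> ?n" using pl' by simp
          show "letter S (?V1 End) \<notin> {..<a}" if "?V1 End \<in> right_ends S"
            using lp right_endsD(3)[OF that] by simp
        next
          fix V2 A2 t2
          assume V2: "same_vars ?V1 V2" and A2: "same_arrs A1 A2"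
            and t2: "t2 \<le> t1 + 15 + 200 * ?n + 300"
            and out2: "if 0 < V2 Ok then ?V1 End \<in> right_ends S \<and>
                (\<exists>C'. valid S C' (insert (letter S (?V1 End)) {..<a}) \<and> owns S C' (A2 Own))
              else A2 Own = A1 Own \<and> excluded S {..<a} (?V1 End)"
          show "wp ?rest ?Q V2 A2 inp' t2"
          proof (rule rest)
            show "same_vars V' V2" using V1' V2 by (simp add: same_vars_def)
            show "same_arrs A' A2" using A1 A2 by (simp add: same_arrs_def)
            show "t2 \<le> t' + 400 * ?n + 640" using t1 t2 by simp
            show "if 0 < V2 Ok then \<exists>C'. valid S C' (insert a {..<a}) \<and> owns S C' (A2 Own)
              else \<nexists>C. valid S C {..<\<sigma>}"
            proof (cases "0 < V2 Ok")
              case True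
              then have "letter S (prv S l) = a" using out2 lp right_endsD(3)[of "prv S l" S] by auto
              then show ?thesis using True out2 by auto
            next
              case False
              then have "excluded S {..<a} (prv S l)" using out2 by simp
              \<comment> \<open>Exclusion was obtained for \<open>{..<a}\<close>; it applies to
                choices for \<open>{..<\<sigma>}\<close> because \<open>excluded\<close> admits
                larger letter sets.\<close>
              then have "e \<notin> C''" if "valid S C'' {..<\<sigma>}" "e \<in> options S a" for C'' e
                using that ex1(2) options_subset[OF count l_def] V'(5) unfolding excluded_def by auto
              moreover have "\<exists>e\<in>C''. e \<in> options S a" if "valid S C'' {..<\<sigma>}" for C''
              proof -
                have "a \<in> letter S ` C''" "C'' \<subseteq> right_ends S"
                  using that V'(2,5) by (simp_all add: valid_def)
                then show ?thesis by (auto simp: options_def)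
              qed
              ultimately have "\<nexists>C. valid S C {..<\<sigma>}" by meson
              then show ?thesis using False by simp
            qed
          qed
        qed
        moreover have "V1 Cur = a" "A1 Last = A' Last" "A1 Prv = A' Prv"
          using V1' A1 by (auto simp: same_vars_def same_arrs_def a_def)
        ultimately show ?thesis using False l(1) pl
          by (simp add: wp_Seq wp_IfPos[of Ok] wp_basic(7) add.commute)
      qed
    qed (use V' l in auto)
    then show "wp (Get End Last Cur ;; attempt ;; ?retry ;; ?rest) ?Q V' A' inp' t'"
      using l(1) by (simp add: wp_Seq wp_basic(7) a_def)
  next
    fix m V' A' inp' t'
    assume "I m V' A' inp' t'" "V' Todo = 0"
    then show "Q V' A' inp' (t' + 3)" by (intro Q) (auto simp: I_def)
  qed
  then show ?thesis using V by (simp add: insert_letters_def wp_Seq wp_basic numeral_eq_Suc)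
qed

lemma FT3_correct:
  assumes "(\<sigma>, S) \<in> FT_instances 3"
  shows "wp FT3 (\<lambda>V A inp t. V Ans = (if FT_solvable (\<sigma>, S) then 1 else 0) \<and>
      t \<le> 2000 * (length S + 1)\<^sup>2) (\<lambda>_. 0) (\<lambda>_ _. 0) (\<sigma> # length S # S) 0"
proof -
  let ?n = "length S" and ?A = "\<lambda>_ _. 0"
  let ?Q = "\<lambda>V A inp t. V Ans = (if FT_solvable (\<sigma>, S) then 1 else 0) \<and> t \<le> 2000 * (?n + 1)\<^sup>2"
  \<comment> \<open>The instance bounds only letters below \<open>\<sigma>\<close>; other numbers do
    not occur in \<open>S\<close>.\<close>
  have count: "count_list S a \<le> 3" for a
  proof (cases "a < \<sigma>")
    case False
    then have "a \<notin> set S" using assms by (auto simp: FT_instances_def)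
    then show ?thesis by (simp add: count_list_0_iff)
  qed (use assms in \<open>auto simp: FT_instances_def\<close>)
  show ?thesis
  proof (cases "?n < \<sigma>")
    case True
    have "\<not> FT_solvable (\<sigma>, S)"
    proof
      assume "FT_solvable (\<sigma>, S)"
      then obtain C where C: "valid S C {..<\<sigma>}" unfolding FT_solvable_iff_valid by blast
      \<comment> \<open>Different letters have different right ends, so a solution needs at least
        \<open>\<sigma>\<close> positions.\<close>
      have "C \<subseteq> {1..?n}" using C right_endsD(3,4)[of _ S] by (fastforce simp: valid_def)
      then have "card C \<le> ?n" using card_mono[of "{1..?n}" C] by simp
      moreover have "card C = \<sigma>" using C card_image[of "letter S" C] by (auto simp: valid_def)
      ultimately show False using True by simp
    qed
    then show ?thesis using True by (simp add: FT3_def wp_simps power2_eq_square)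
  next
    case False
    let ?V = "(\<lambda>_. 0)(Alph := \<sigma>, Len := ?n, Tmp := 0)"
    have "wp load (wp insert_letters ?Q) ?V ?A S 6"
    proof (rule load_correct)
      show "?V Len = ?n" by simp
      show "tables S 0 ?A" by (auto simp: tables_def)
    next
      fix V A inp t
      assume V: "V Len = ?V Len" "V Alph = ?V Alph" and A: "A Own = ?A Own" "tables S ?n A"
        and t: "t \<le> 6 + 40 * ?n + 10"
      show "wp insert_letters ?Q V A inp t"
      proof (rule insert_letters_correct[OF count, where \<sigma> = \<sigma>])
        fix V' :: "var \<Rightarrow> nat" and A' :: "arr \<Rightarrow> nat \<Rightarrow> nat" and inp' :: "nat list" and t' :: nat
        assume V': "V' Ans = (if \<exists>C. valid S C {..<\<sigma>} then 1 else 0)"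
          and t': "t' \<le> t + (400 * ?n + 700) * \<sigma> + 20"
        \<comment> \<open>Here the rejection of large alphabets pays off:
          \<open>\<sigma> \<le> ?n\<close> makes the bound quadratic in the length.\<close>
        have "(400 * ?n + 700) * \<sigma> \<le> (400 * ?n + 700) * ?n" using False by (intro mult_left_mono) auto
        also have "\<dots> \<le> 400 * ?n\<^sup>2 + 700 * ?n" by (simp add: power2_eq_square algebra_simps)
        finally have "t' \<le> 400 * ?n\<^sup>2 + 740 * ?n + 36" using t t' by simp
        also have "\<dots> \<le> 2000 * (?n + 1)\<^sup>2" by (simp add: power2_eq_square)
        finally show "V' Ans = (if FT_solvable (\<sigma>, S) then 1 else 0) \<and> t' \<le> 2000 * (?n + 1)\<^sup>2"
          using V' unfolding FT_solvable_iff_valid by simp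
      qed (use V A in auto)
    qed
    then show ?thesis using False by (simp add: FT3_def wp_simps)
  qed
qed

section \<open>Time and word bounds on the machine\<close>

lemma halted_stays: "halted p c \<Longrightarrow> (step p ^^ k) c = c"
  by (induction k) (auto simp: step_def)

theorem theorem2:
  "decidable_in_time_O (FT_instances 3) FT_encoding FT_size FT_solvable (\<lambda>n. real n ^ 2)"
  unfolding decidable_in_time_O_def
proof (intro exI conjI ballI)
  let ?p = "compile FT3 0" and ?T = "\<lambda>n. 2000 * (n + 1)\<^sup>2 :: nat"
  show "(\<lambda>n. real (?T n)) \<in> O(\<lambda>n. real n ^ 2)"
  \<comment> \<open>For \<open>n \<ge> 1\<close> one has \<open>n + 1 \<le> 2 * n\<close>, so 4
    times 2000 suffices.\<close>
  proof (rule bigoI[of _ 8000])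
    show "\<forall>\<^sub>F n in sequentially. norm (real (?T n)) \<le> 8000 * norm (real n ^ 2)"
      using eventually_ge_at_top[of 1]
    proof eventually_elim
      case (elim n)
      then have "(real n + 1)\<^sup>2 \<le> (2 * real n)\<^sup>2" by (intro power_mono) auto
      then show ?case by (simp add: power_mult_distrib add.commute)
    qed
  qed
  fix x assume x: "x \<in> FT_instances 3"
  obtain \<sigma> S where xS: "x = (\<sigma>, S)" by (cases x)
  define xs where "xs = FT_encoding x"
  have xs: "xs = \<sigma> # length S # S" by (simp add: xs_def xS FT_encoding_def)
  define m where "m = Max (insert 0 (set xs))"
  from FT3_correct[of \<sigma> S] x obtain u V A inp where
    bs: "big_step FT3 (\<lambda>_. 0, \<lambda>_ _. 0, xs) u (V, A, inp)"
    and V: "V Ans = (if FT_solvable x then 1 else 0)" and u: "u \<le> ?T (length S)"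
    unfolding wp_def xs xS by auto
  define b where "b = 8 * (m + u) + 64"
  have "bounded_store m (\<lambda>_. 0, \<lambda>_ _. 0, xs)" by (simp add: bounded_store_def m_def)
  moreover have "code_at ?p 0 ?p" unfolding code_at_def by (intro exI[of _ "[]"]) simp
  ultimately obtain X' where X': "runs ?p b (0, \<lambda>_. 0, xs) u (code_size FT3, X', inp)" "represents X' V A"
    using compile_correct[OF bs, of ?p 0 "\<lambda>_. 0" "\<lambda>_ _. 0" xs "\<lambda>_. 0" m "m + u" b]
    by (auto simp: b_def represents_def)
  have run_u: "run ?p xs u = (code_size FT3, X', inp)" using X'(1) by (simp add: runs_def run_def)
  then have halt: "halted ?p (run ?p xs u)" by (simp add: halted_def)
  have late: "run ?p xs t = run ?p xs u" if "u \<le> t" for t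
  proof -
    have "run ?p xs t = (step ?p ^^ (t - u)) (run ?p xs u)"
      using that funpow_add[of "t - u" u "step ?p"] by (simp add: run_def)
    then show ?thesis using halted_stays[OF halt] by simp
  qed
  have "reg (run ?p xs u) 0 = (if FT_solvable x then 1 else 0)"
    using represents_reg[OF X'(2), of Ans] V by (simp add: run_u reg_def)
  then show "decides_within ?p (FT_encoding x) (FT_solvable x) (?T (FT_size x))"
    using late[of "?T (FT_size x)"] u halt
    unfolding decides_within_def xs_def[symmetric] by (simp add: FT_size_def xS)
  \<comment> \<open>The bound \<open>b\<close> is at most \<open>16384 * ?N\<^sup>2\<close>, where
    \<open>16384 = 4 ^ 7\<close>. The encoding has at least two entries, so
    \<open>?N \<ge> 4\<close> and the constant is absorbed into \<open>?N ^ 7\<close>; hence the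
    exponent 9.\<close>
  show "word_bounded ?p 9 (FT_encoding x)"
    unfolding word_bounded_def xs_def[symmetric] m_def[symmetric]
  proof (intro allI)
    fix t i
    let ?N = "length xs + m + 2"
    \<comment> \<open>After time \<open>u\<close> the halted configuration no longer changes, so the
      times up to \<open>u\<close> decide.\<close>
    have "reg (run ?p xs (min t u)) i \<le> b" using X'(1) by (simp add: runs_def run_def)
    then have "reg (run ?p xs t) i \<le> b" using late[of t] by (cases "t \<le> u") (auto simp: min_def)
    also have "b \<le> ?N ^ 9"
    proof -
      have N: "4 \<le> ?N" "m \<le> ?N" "length S + 1 \<le> ?N" by (auto simp: xs)
      have "(length S + 1)\<^sup>2 \<le> ?N\<^sup>2" by (rule power_mono[OF N(3)]) simp
      then have "u \<le> 2000 * ?N\<^sup>2" using u by linarith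
      moreover have "4 * ?N \<le> ?N\<^sup>2" unfolding power2_eq_square using N(1) by (rule mult_right_mono) simp
      moreover have "8 * (m + u) + 64 \<le> 16384 * q" if "u \<le> 2000 * q" "4 * ?N \<le> q" for q
      proof -
        have "8 * m \<le> 2 * q" "64 \<le> 4 * q" using that(2) N(1) by simp_all
        then show ?thesis using that(1) by simp
      qed
      ultimately have "b \<le> 16384 * ?N\<^sup>2" unfolding b_def by blast
      also have "(16384 :: nat) = 4 ^ 7" by simp
      also have "4 ^ 7 * ?N\<^sup>2 \<le> ?N ^ 7 * ?N\<^sup>2" using power_mono[OF N(1), of 7] by (intro mult_right_mono) auto
      also have "\<dots> = ?N ^ 9" by (simp flip: power_add)
      finally show ?thesis .
    qed
    finally show "reg (run ?p xs t) i \<le> ?N ^ 9" .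
  qed
qed

end
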